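(* Assume that $\mathbb{P}^{\alpha,y}(T_A<\infty)=1$ for all $y\in S_Y$, and that $\alpha=0$. Then there exists an invariant measure $\Pi$ for $Y=(N,\Lambda)$, given, for $\lambda\in[\lambda^o,A)$, by $$\Pi(0,d\lambda)=\frac{K_0}{\lambda^o}\,\delta_{\lambda^o}(d\lambda),\qquad \Pi(1,d\lambda)=\frac{K_0}{\lambda}\,dG_\ell(1,\lambda-\lambda^o),$$ $$\Pi(n,d\lambda)=\frac1\lambda\,H_n(d\lambda),\qquad n\ge2,$$ where $\overline\Pi(n,d\lambda):=\lambda\,\Pi(n,d\lambda)$ and $H_n:=G_\ell(n,\cdot)\star\overline\Pi(n-1,\cdot)$ is the convolution of the law with distribution function $G_\ell(n,\cdot)$ with the measure $\overline\Pi(n-1,\cdot)$, and where $$K_0=\sum_{n=1}^\infty\int_{[\lambda^o,A)}\lambda\,\bar G_\ell(n,(A-\lambda)-)\,\Pi(n-1,d\lambda).$$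
   Context: Constants: $\alpha\ge 0$, $\beta>0$, $A\in(\beta,\infty)$, $\lambda^o\in(0,\beta]$. $(Z_i)_{i\ge1}$ are i.i.d. $[0,\infty)$-valued random variables with distribution function $G$ and finite second moment. $\ell(n,z)$ ($n\ge1$, $z\ge0$) is a strictly positive function such that, for each $n$, $z\mapsto\ell(n,z)$ is non-decreasing and continuous. $G_\ell(n,\cdot)$ is the distribution function of $\ell(n,Z_n)$; $\bar G_\ell:=1-G_\ell$, and $\bar G_\ell(n,a-)$ is the left limit at $a$, i.e. the probability that $\ell(n,Z_n)\ge a$. $Y=(N,\Lambda)$ is the (first two components of the) self-exciting piecewise-deterministic Markov process with resetting: the right-continuous Markov process on $S_Y=(\mathbb{N}\cup\{0\})\times[\lambda^o,A)$ such that between jumps $d\Lambda_t=\alpha(\beta-\Lambda_t)dt$ (so $\Lambda$ is constant between jumps when $\alpha=0$) and $N$ is constant; jumps occur at rate $\Lambda$; at a jump, with mark $Z$ freshly drawn from $G$, $(N,\Lambda)$ moves from $(n,\lambda)$ to $(n+1,\lambda+\ell(n+1,Z))$ if $\lambda+\ell(n+1,Z)<A$, and to $(0,\lambda^o)$ (a reset) otherwise. $T_A$ is the time of the first reset. $\mathbb{P}^{\alpha,y}$ is the law when $Y_0=y$. A measure on $S_Y$ is written $\Pi(n,d\lambda)$; all measures $\Pi(n,\cdot)$ are on $[\lambda^o,A)$ (the formulas being restricted to that interval). A measure is invariant if it is preserved by the transition semigroup of $Y$. Invariant measures are considered up to a multiplicative scaling (so that $K_0$ is fixed by the choice of scaling).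 *)

theory Defs
  imports "HOL-Probability.Probability"
begin

section \<open>The process\<close>

text \<open>
  Throughout, \<open>l\<close> is the lower end \<open>\<lambda>\<^sup>o\<close> of the intensity range and also the value to which
  \<open>\<Lambda>\<close> is reset. A state is a pair \<open>(n, x)\<close> of a count and an intensity.
\<close>

definition S_Y :: "real \<Rightarrow> real \<Rightarrow> (nat \<times> real) set" where
  "S_Y l A = UNIV \<times> {l..<A}"

definition state_space :: "real \<Rightarrow> real \<Rightarrow> (nat \<times> real) measure" where
  "state_space l A = restrict_space (count_space UNIV \<Otimes>\<^sub>M borel) (S_Y l A)"

text \<open>The solution at time \<open>t\<close> of \<open>dx = \<alpha> (\<beta> - x) dt\<close> started from \<open>x\<close>.\<close>

definition flow :: "real \<Rightarrow> real \<Rightarrow> real \<Rightarrow> real \<Rightarrow> real" where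
  "flow \<alpha> \<beta> t x = \<beta> + (x - \<beta>) * exp (- \<alpha> * t)"

text \<open>
  The time that the intensity, started from \<open>x\<close> and following the flow, needs to accumulate the
  amount \<open>e\<close>. If \<open>e\<close> is a standard exponential variable, this is the first jump time at rate
  \<open>\<Lambda>\<close>: it exceeds \<open>t\<close> with probability \<open>exp (- (\<integral>\<^sub>0\<^sup>t flow \<alpha> \<beta> s x ds))\<close>.
\<close>

definition waiting_time :: "real \<Rightarrow> real \<Rightarrow> real \<Rightarrow> real \<Rightarrow> real" where
  "waiting_time \<alpha> \<beta> x e = Inf {t. 0 \<le> t \<and> e \<le> integral {0..t} (\<lambda>s. flow \<alpha> \<beta> s x)}"

definition jump :: "real \<Rightarrow> real \<Rightarrow> (nat \<Rightarrow> real \<Rightarrow> real) \<Rightarrow> nat \<times> real \<Rightarrow> real \<Rightarrow> nat \<times> real" where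
  "jump l A ell = (\<lambda>(n, x) z.
     if x + ell (Suc n) z < A then (Suc n, x + ell (Suc n) z) else (0, l))"

text \<open>
  The driving randomness \<open>\<omega>\<close> is a sequence of pairs; \<open>\<omega> k\<close> holds the standard exponential
  variable and the mark used for the jump with index \<open>k\<close> (counting from \<open>0\<close>). The law of the marks
  is the one with distribution function \<open>G\<close>. It lives on \<open>[0,\<infty>)\<close>, because nothing is assumed of
  \<open>ell n\<close> (not even measurability) on the negative half-line.
\<close>

definition mark_law :: "(real \<Rightarrow> real) \<Rightarrow> real measure" where
  "mark_law G = restrict_space (interval_measure G) {0..}"

definition driving_space :: "(real \<Rightarrow> real) \<Rightarrow> (nat \<Rightarrow> real \<times> real) measure" where
  "driving_space G =
     PiM UNIV (\<lambda>_. density lborel (\<lambda>e. ennreal (exponential_density 1 e)) \<Otimes>\<^sub>M mark_law G)"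

text \<open>
  \<open>post_jump \<dots> y \<omega> k\<close> is the state just after the first \<open>k\<close> jumps (so \<open>y\<close> itself for \<open>k = 0\<close>), and
  \<open>pre_jump \<dots> y \<omega> k\<close> the state just before the next jump, when the process starts at \<open>y\<close>.
\<close>

definition pre_jump_state ::
    "real \<Rightarrow> real \<Rightarrow> nat \<times> real \<Rightarrow> real \<Rightarrow> nat \<times> real" where
  "pre_jump_state \<alpha> \<beta> = (\<lambda>(n, x) e. (n, flow \<alpha> \<beta> (waiting_time \<alpha> \<beta> x e) x))"

primrec post_jump ::
    "real \<Rightarrow> real \<Rightarrow> real \<Rightarrow> real \<Rightarrow> (nat \<Rightarrow> real \<Rightarrow> real) \<Rightarrow> nat \<times> real \<Rightarrow> (nat \<Rightarrow> real \<times> real)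
      \<Rightarrow> nat \<Rightarrow> nat \<times> real" where
  "post_jump \<alpha> \<beta> l A ell y \<omega> 0 = y"
| "post_jump \<alpha> \<beta> l A ell y \<omega> (Suc k) =
     jump l A ell (pre_jump_state \<alpha> \<beta> (post_jump \<alpha> \<beta> l A ell y \<omega> k) (fst (\<omega> k))) (snd (\<omega> k))"

definition pre_jump ::
    "real \<Rightarrow> real \<Rightarrow> real \<Rightarrow> real \<Rightarrow> (nat \<Rightarrow> real \<Rightarrow> real) \<Rightarrow> nat \<times> real \<Rightarrow> (nat \<Rightarrow> real \<times> real)
      \<Rightarrow> nat \<Rightarrow> nat \<times> real" where
  "pre_jump \<alpha> \<beta> l A ell y \<omega> k =
     pre_jump_state \<alpha> \<beta> (post_jump \<alpha> \<beta> l A ell y \<omega> k) (fst (\<omega> k))"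

definition jump_time ::
    "real \<Rightarrow> real \<Rightarrow> real \<Rightarrow> real \<Rightarrow> (nat \<Rightarrow> real \<Rightarrow> real) \<Rightarrow> nat \<times> real \<Rightarrow> (nat \<Rightarrow> real \<times> real)
      \<Rightarrow> nat \<Rightarrow> real" where
  "jump_time \<alpha> \<beta> l A ell y \<omega> k =
     (\<Sum>j<k. waiting_time \<alpha> \<beta> (snd (post_jump \<alpha> \<beta> l A ell y \<omega> j)) (fst (\<omega> j)))"

text \<open>
  The process at time \<open>t\<close>, started at \<open>y\<close>. Here \<open>k\<close> is the number of jumps up to time \<open>t\<close>. Since the
  intensity is bounded by \<open>A\<close>, the jump times almost surely tend to infinity; on the
  exceptional null set \<open>k\<close> is an arbitrary number.
\<close>

definition Y ::
    "real \<Rightarrow> real \<Rightarrow> real \<Rightarrow> real \<Rightarrow> (nat \<Rightarrow> real \<Rightarrow> real) \<Rightarrow> nat \<times> real \<Rightarrow> real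
      \<Rightarrow> (nat \<Rightarrow> real \<times> real) \<Rightarrow> nat \<times> real" where
  "Y \<alpha> \<beta> l A ell y t \<omega> =
     (let k = (LEAST k. t < jump_time \<alpha> \<beta> l A ell y \<omega> (Suc k));
          (n, x) = post_jump \<alpha> \<beta> l A ell y \<omega> k
      in (n, flow \<alpha> \<beta> (t - jump_time \<alpha> \<beta> l A ell y \<omega> k) x))"

text \<open>
  The jump with index \<open>k\<close> is a reset iff the intensity would reach \<open>A\<close> or more. The infimum is
  \<open>\<infinity>\<close> if there is no reset.
\<close>

definition is_reset ::
    "real \<Rightarrow> real \<Rightarrow> real \<Rightarrow> real \<Rightarrow> (nat \<Rightarrow> real \<Rightarrow> real) \<Rightarrow> nat \<times> real \<Rightarrow> (nat \<Rightarrow> real \<times> real)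
      \<Rightarrow> nat \<Rightarrow> bool" where
  "is_reset \<alpha> \<beta> l A ell y \<omega> k \<longleftrightarrow>
     (case pre_jump \<alpha> \<beta> l A ell y \<omega> k of (n, x) \<Rightarrow> A \<le> x + ell (Suc n) (snd (\<omega> k)))"

definition T_A ::
    "real \<Rightarrow> real \<Rightarrow> real \<Rightarrow> real \<Rightarrow> (nat \<Rightarrow> real \<Rightarrow> real) \<Rightarrow> nat \<times> real \<Rightarrow> (nat \<Rightarrow> real \<times> real)
      \<Rightarrow> ereal" where
  "T_A \<alpha> \<beta> l A ell y \<omega> =
     (INF k \<in> {k. is_reset \<alpha> \<beta> l A ell y \<omega> k}. ereal (jump_time \<alpha> \<beta> l A ell y \<omega> (Suc k)))"

section \<open>Invariant measures\<close>

definition transition ::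
    "(real \<Rightarrow> real) \<Rightarrow> real \<Rightarrow> real \<Rightarrow> real \<Rightarrow> real \<Rightarrow> (nat \<Rightarrow> real \<Rightarrow> real) \<Rightarrow> real \<Rightarrow> nat \<times> real
      \<Rightarrow> (nat \<times> real) measure" where
  "transition G \<alpha> \<beta> l A ell t y =
     distr (driving_space G) (state_space l A) (Y \<alpha> \<beta> l A ell y t)"

text \<open>Invariant measures need be neither probability measures nor finite.\<close>

definition invariant_measure ::
    "(real \<Rightarrow> real) \<Rightarrow> real \<Rightarrow> real \<Rightarrow> real \<Rightarrow> real \<Rightarrow> (nat \<Rightarrow> real \<Rightarrow> real)
      \<Rightarrow> (nat \<times> real) measure \<Rightarrow> bool" where
  "invariant_measure G \<alpha> \<beta> l A ell \<mu> \<longleftrightarrow>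
     sets \<mu> = sets (state_space l A) \<and>
     (\<forall>t\<ge>0. \<forall>B\<in>sets (state_space l A).
        (\<integral>\<^sup>+y. emeasure (transition G \<alpha> \<beta> l A ell t y) B \<partial>\<mu>) = emeasure \<mu> B)"

text \<open>
  The measure \<open>\<mu>(n, dx)\<close>, regarded as a Borel measure on the real line that is concentrated
  on \<open>[l, A)\<close>.
\<close>

definition slice :: "(nat \<times> real) measure \<Rightarrow> nat \<Rightarrow> real measure" where
  "slice \<mu> n = distr (restrict_space \<mu> ({n} \<times> UNIV)) borel snd"

definition weighted_slice :: "(nat \<times> real) measure \<Rightarrow> nat \<Rightarrow> real measure" where
  "weighted_slice \<mu> n = density (slice \<mu> n) (\<lambda>x. ennreal x)"

definition G_ell ::
    "'w measure \<Rightarrow> (nat \<Rightarrow> 'w \<Rightarrow> real) \<Rightarrow> (nat \<Rightarrow> real \<Rightarrow> real) \<Rightarrow> nat \<Rightarrow> real \<Rightarrow> real" where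
  "G_ell M Z ell n = cdf (distr M borel (\<lambda>\<omega>. ell n (Z n \<omega>)))"

text \<open>The left limit at \<open>a\<close> of \<open>1 - G_ell n\<close>.\<close>

definition G_ell_bar_left ::
    "'w measure \<Rightarrow> (nat \<Rightarrow> 'w \<Rightarrow> real) \<Rightarrow> (nat \<Rightarrow> real \<Rightarrow> real) \<Rightarrow> nat \<Rightarrow> real \<Rightarrow> real" where
  "G_ell_bar_left M Z ell n a = Lim (at_left a) (\<lambda>x. 1 - G_ell M Z ell n x)"

definition H ::
    "'w measure \<Rightarrow> (nat \<Rightarrow> 'w \<Rightarrow> real) \<Rightarrow> (nat \<Rightarrow> real \<Rightarrow> real) \<Rightarrow> (nat \<times> real) measure \<Rightarrow> nat
      \<Rightarrow> real measure" where
  "H M Z ell \<mu> n = convolution (interval_measure (G_ell M Z ell n)) (weighted_slice \<mu> (n - 1))"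

end

theory Submission
  imports Defs
begin

text \<open>
  For \<open>\<alpha> = 0\<close> the process is a pure jump process with bounded rate \<open>\<Lambda>\<close>, so \<open>\<mu>\<close> is invariant as soon
  as \<open>\<nu>(dn, dx) = x \<mu>(dn, dx)\<close> is invariant for the embedded jump chain. Let \<open>\<nu>\<close> be \<open>K0\<close> times the
  occupation measure of one excursion of that chain from \<open>(0, l)\<close>. Its part at count \<open>n\<close> is the law of
  the intensity after \<open>n\<close> jumps without reset, which is the recursion by convolutions. The total mass
  that \<open>\<nu>\<close> sends to \<open>(0, l)\<close> is \<open>K0\<close>, by telescoping, because a reset occurs almost surely; hence \<open>\<nu>\<close>
  is invariant. Total masses may be infinite, so invariance in continuous time is obtained without
  subtraction: with \<open>Q\<close> the kernel of the chain, the uniformised kernel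
  \<open>(x / A) Q + (1 - x / A) I\<close> preserves \<open>\<mu>\<close>, hence so does every
  Poisson mixture of its powers. These mixtures solve the same backward equation as the transition
  probabilities of the process killed at explosion, and its bounded solution is unique by contraction.
  Applied to the whole space this also shows that explosion has probability zero.
\<close>

section \<open>Pure jump dynamics\<close>

text \<open>For zero drift the flow is constant, so the amount accumulated by time \<open>t\<close>
  is \<open>t * x\<close>. The infimum ranges over nonnegative times only, which produces the
  maximum when \<open>e\<close> is negative.\<close>

lemma waiting_time_zero:
  assumes "0 < x"
  shows "waiting_time 0 \<beta> x e = max 0 (e / x)"
proof -
  have "e \<le> integral {0..t} (\<lambda>s. flow 0 \<beta> s x) \<longleftrightarrow> e / x \<le> t" if "0 \<le> t" for t
    using assms that by (simp add: flow_def field_simps)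
  then have "{t. 0 \<le> t \<and> e \<le> integral {0..t} (\<lambda>s. flow 0 \<beta> s x)} = {max 0 (e / x)..}"
    by auto
  then show ?thesis
    by (simp add: waiting_time_def)
qed

lemma pre_jump_state_zero: "pre_jump_state 0 \<beta> y e = y"
  by (simp add: pre_jump_state_def flow_def split: prod.splits)

lemma jump_eq:
  "jump l A ell y z =
     (if snd y + ell (Suc (fst y)) z < A then (Suc (fst y), snd y + ell (Suc (fst y)) z) else (0, l))"
  by (simp add: jump_def split: prod.splits)

text \<open>Pathwise Markov property: prepending a driving pair amounts to making one jump and then
  restarting. Without drift the exponential variable does not affect the state, so only the mark
  \<open>snd s\<close> enters.\<close>

lemma post_jump_case_nat:
  "post_jump 0 \<beta> l A ell y (case_nat s \<omega>) (Suc k) = post_jump 0 \<beta> l A ell (jump l A ell y (snd s)) \<omega> k"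
  by (induction k) (simp_all add: pre_jump_state_zero)

lemma jump_time_case_nat:
  "jump_time 0 \<beta> l A ell y (case_nat s \<omega>) (Suc k) =
     waiting_time 0 \<beta> (snd y) (fst s) + jump_time 0 \<beta> l A ell (jump l A ell y (snd s)) \<omega> k"
  unfolding jump_time_def
  by (subst sum.lessThan_Suc_shift) (simp add: post_jump_case_nat del: post_jump.simps(2))

lemma Y_zero:
  "Y 0 \<beta> l A ell y t \<omega> =
     post_jump 0 \<beta> l A ell y \<omega> (LEAST k. t < jump_time 0 \<beta> l A ell y \<omega> (Suc k))"
  by (simp add: Y_def flow_def split: prod.splits)

text \<open>Writing the index of \<open>ell\<close> as \<open>Suc n\<close> builds in the
  restriction to positive indices. The mark law enters only as a probability measure; its relation
  to the variables \<open>Z\<close> is established in the final theorem.\<close>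

locale resetting_process =
  fixes G :: "real \<Rightarrow> real" and \<beta> l A :: real and ell :: "nat \<Rightarrow> real \<Rightarrow> real"
  assumes mark_prob: "prob_space (mark_law G)"
    and l_pos: "0 < l" and l_less: "l < A"
    and ell_pos: "\<And>n z. 0 \<le> z \<Longrightarrow> 0 < ell (Suc n) z"
    and ell_cont: "\<And>n. continuous_on {0..} (ell (Suc n))"
begin

abbreviation "Sp \<equiv> state_space l A"
abbreviation "Mk \<equiv> mark_law G"
abbreviation "Ed \<equiv> density lborel (\<lambda>e. ennreal (exponential_density 1 e))"
abbreviation "D \<equiv> driving_space G"
abbreviation "J \<equiv> jump l A ell"
abbreviation "X \<equiv> post_jump 0 \<beta> l A ell"
abbreviation "T \<equiv> jump_time 0 \<beta> l A ell"

section \<open>State space and measurability of a jump\<close>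

lemma space_Sp: "space Sp = UNIV \<times> {l..<A}"
  by (simp add: state_space_def S_Y_def space_restrict_space space_pair_measure)

lemma space_Mk: "space Mk = {0..}"
  by (simp add: mark_law_def space_restrict_space)

lemma sets_Mk: "sets Mk = sets (restrict_space borel {0..})"
  unfolding mark_law_def by (rule sets_restrict_space_cong) simp

lemma start_in_space [measurable]: "(0, l) \<in> space Sp"
  using l_less by (simp add: space_Sp)

lemma snd_pos: "y \<in> space Sp \<Longrightarrow> 0 < snd y" "y \<in> space Sp \<Longrightarrow> snd y < A"
    "y \<in> space Sp \<Longrightarrow> l \<le> snd y"
  using l_pos by (auto simp: space_Sp)

lemma A_pos: "0 < A"
  using l_pos l_less by simp

lemma jump_in_space:
  assumes "y \<in> space Sp" "z \<in> space Mk"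
  shows "J y z \<in> space Sp"
  using assms l_less ell_pos[of z "fst y"] by (auto simp: space_Sp space_Mk jump_eq)

lemma measurable_fst_Sp [measurable]: "fst \<in> Sp \<rightarrow>\<^sub>M count_space UNIV"
  unfolding state_space_def by (intro measurable_restrict_space1) simp

lemma measurable_snd_Sp [measurable]: "snd \<in> Sp \<rightarrow>\<^sub>M borel"
  unfolding state_space_def by (intro measurable_restrict_space1) simp

lemma measurable_ell [measurable]: "ell (Suc n) \<in> borel_measurable Mk"
  using borel_measurable_continuous_on_restrict[OF ell_cont]
  by (simp add: measurable_cong_sets[OF sets_Mk refl])

lemma measurable_increment [measurable]: "(\<lambda>(y, z). ell (Suc (fst y)) z) \<in> borel_measurable (Sp \<Otimes>\<^sub>M Mk)"
proof -
  have "(\<lambda>p. ell (Suc (fst (fst p))) (snd p)) \<in> borel_measurable (Sp \<Otimes>\<^sub>M Mk)"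
    \<comment> \<open>The count selects the function \<open>ell (Suc n)\<close>; joint measurability
      follows because it takes countably many values.\<close>
    by (rule measurable_compose_countable[where g = "\<lambda>p. fst (fst p)"
          and f = "\<lambda>n p. ell (Suc n) (snd p)"]) measurable
  then show ?thesis by (simp add: case_prod_beta)
qed

lemma measurable_jump [measurable]: "(\<lambda>(y, z). J y z) \<in> Sp \<Otimes>\<^sub>M Mk \<rightarrow>\<^sub>M Sp"
proof -
  have [measurable]: "(\<lambda>p. ell (Suc (fst (fst p))) (snd p)) \<in> borel_measurable (Sp \<Otimes>\<^sub>M Mk)"
    using measurable_increment by (simp add: case_prod_beta)
  have "(\<lambda>p. J (fst p) (snd p)) \<in> Sp \<Otimes>\<^sub>M Mk \<rightarrow>\<^sub>M count_space UNIV \<Otimes>\<^sub>M borel"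
    unfolding jump_eq by measurable
  then have "(\<lambda>p. J (fst p) (snd p)) \<in> Sp \<Otimes>\<^sub>M Mk \<rightarrow>\<^sub>M Sp"
    using jump_in_space
    by (subst (2) state_space_def, intro measurable_restrict_space2)
       (auto simp: space_pair_measure space_Sp S_Y_def)
  then show ?thesis by (simp add: case_prod_beta)
qed

section \<open>Driving sequence and first-step decomposition\<close>

lemma driving_sequence_space: "sequence_space (Ed \<Otimes>\<^sub>M Mk)"
proof -
  have "prob_space (Ed \<Otimes>\<^sub>M Mk)"
    using prob_space_exponential_density[of 1] mark_prob by (intro prob_space_pair) auto
  then show ?thesis
    unfolding sequence_space_def product_prob_space_def product_prob_space_axioms_def
      product_sigma_finite_def
    by (simp add: prob_space_imp_sigma_finite)
qed

lemma prob_space_D: "prob_space D"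
proof -
  interpret sequence_space "Ed \<Otimes>\<^sub>M Mk" by (rule driving_sequence_space)
  show ?thesis
    using prob_space_axioms by (simp add: driving_space_def)
qed

lemma sets_D: "sets D = sets (PiM UNIV (\<lambda>_. borel \<Otimes>\<^sub>M Mk))"
  unfolding driving_space_def by (intro sets_PiM_cong sets_pair_measure_cong) auto

lemma measurable_mark [measurable (raw)]:
  assumes [measurable]: "f \<in> N \<rightarrow>\<^sub>M D"
  shows "(\<lambda>x. snd (f x k)) \<in> N \<rightarrow>\<^sub>M Mk"
proof -
  have [measurable]: "f \<in> N \<rightarrow>\<^sub>M PiM UNIV (\<lambda>_. borel \<Otimes>\<^sub>M Mk)"
    using assms by (simp add: measurable_cong_sets[OF refl sets_D])
  show ?thesis by measurable
qed

lemma measurable_exp [measurable (raw)]: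
  assumes "f \<in> N \<rightarrow>\<^sub>M D"
  shows "(\<lambda>x. fst (f x k)) \<in> borel_measurable N"
proof -
  have [measurable]: "f \<in> N \<rightarrow>\<^sub>M PiM UNIV (\<lambda>_. borel \<Otimes>\<^sub>M Mk)"
    using assms by (simp add: measurable_cong_sets[OF refl sets_D])
  show ?thesis by measurable
qed

lemma post_jump_measurable [measurable (raw)]:
  assumes [measurable]: "f \<in> N \<rightarrow>\<^sub>M Sp" "g \<in> N \<rightarrow>\<^sub>M D"
  shows "(\<lambda>x. X (f x) (g x) k) \<in> N \<rightarrow>\<^sub>M Sp"
  by (induction k) (simp_all add: pre_jump_state_zero)

lemma post_jump_in_space: "y \<in> space Sp \<Longrightarrow> \<omega> \<in> space D \<Longrightarrow> X y \<omega> k \<in> space Sp"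
  using measurable_space[OF post_jump_measurable[of fst "Sp \<Otimes>\<^sub>M D" snd k], of "(y, \<omega>)"]
  by (simp add: space_pair_measure)

text \<open>The closed form of the waiting time requires a positive intensity, hence the restriction
  to points of the two spaces. It replaces the infimum by an expression whose measurability is
  evident.\<close>

lemma jump_time_eq:
  assumes "y \<in> space Sp" "\<omega> \<in> space D"
  shows "T y \<omega> k = (\<Sum>j<k. max 0 (fst (\<omega> j) / snd (X y \<omega> j)))"
  unfolding jump_time_def
  by (intro sum.cong refl waiting_time_zero snd_pos(1) post_jump_in_space assms)

lemma jump_time_measurable [measurable (raw)]:
  assumes [measurable]: "f \<in> N \<rightarrow>\<^sub>M Sp" "g \<in> N \<rightarrow>\<^sub>M D"
  shows "(\<lambda>x. T (f x) (g x) k) \<in> borel_measurable N"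
proof -
  have "(\<lambda>x. \<Sum>j<k. max 0 (fst (g x j) / snd (X (f x) (g x) j))) \<in> borel_measurable N"
    by measurable
  then show ?thesis
    by (rule measurable_cong[THEN iffD1, rotated])
       (use assms[THEN measurable_space] in \<open>simp add: jump_time_eq\<close>)
qed

text \<open>Prepending an independent pair to a sequence with law \<open>D\<close> gives
  \<open>D\<close> again; Tonelli then separates the first pair. Every conditioning on the first
  jump below goes through this formula.\<close>

lemma nn_integral_D:
  assumes [measurable]: "F \<in> borel_measurable D"
  shows "(\<integral>\<^sup>+\<omega>. F \<omega> \<partial>D) = (\<integral>\<^sup>+e. \<integral>\<^sup>+z. \<integral>\<^sup>+\<omega>. F (case_nat (e, z) \<omega>) \<partial>D \<partial>Mk \<partial>Ed)"
proof -
  interpret S: sequence_space "Ed \<Otimes>\<^sub>M Mk" by (rule driving_sequence_space)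
  interpret Mk: prob_space Mk by (rule mark_prob)
  interpret D: prob_space D by (rule prob_space_D)
  have iter: "distr ((Ed \<Otimes>\<^sub>M Mk) \<Otimes>\<^sub>M D) D (\<lambda>(s, \<omega>). case_nat s \<omega>) = D"
    using S.PiM_iter by (simp add: driving_space_def)
  have meas [measurable]: "(\<lambda>(s, \<omega>). case_nat s \<omega>) \<in> (Ed \<Otimes>\<^sub>M Mk) \<Otimes>\<^sub>M D \<rightarrow>\<^sub>M D"
    unfolding driving_space_def by measurable
  have "(\<integral>\<^sup>+\<omega>. F \<omega> \<partial>D) = (\<integral>\<^sup>+p. F ((\<lambda>(s, \<omega>). case_nat s \<omega>) p) \<partial>((Ed \<Otimes>\<^sub>M Mk) \<Otimes>\<^sub>M D))"
    by (subst iter[symmetric], subst nn_integral_distr) auto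
  also have "\<dots> = (\<integral>\<^sup>+s. \<integral>\<^sup>+\<omega>. F (case_nat s \<omega>) \<partial>D \<partial>(Ed \<Otimes>\<^sub>M Mk))"
    by (subst D.nn_integral_fst[symmetric]) auto
  also have "\<dots> = (\<integral>\<^sup>+e. \<integral>\<^sup>+z. \<integral>\<^sup>+\<omega>. F (case_nat (e, z) \<omega>) \<partial>D \<partial>Mk \<partial>Ed)"
    by (subst Mk.nn_integral_fst[symmetric]) measurable
  finally show ?thesis .
qed

section \<open>Embedded jump chain with and without killing\<close>

text \<open>The one-step operator of the embedded jump chain, that is, the kernel \<open>Q\<close>
  of the outline acting on functions.\<close>

definition jump_op :: "(nat \<times> real \<Rightarrow> ennreal) \<Rightarrow> nat \<times> real \<Rightarrow> ennreal" where
  "jump_op h y = (\<integral>\<^sup>+z. h (J y z) \<partial>Mk)"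

text \<open>The one-step operator of the chain killed at its first reset; its powers at
  \<open>(0, l)\<close> describe one excursion.\<close>

definition killed_op :: "(nat \<times> real \<Rightarrow> ennreal) \<Rightarrow> nat \<times> real \<Rightarrow> ennreal" where
  "killed_op h y = (\<integral>\<^sup>+z. (if A \<le> snd y + ell (Suc (fst y)) z then 0 else h (J y z)) \<partial>Mk)"

definition reset_prob :: "nat \<times> real \<Rightarrow> ennreal" where
  "reset_prob y = (\<integral>\<^sup>+z. (if A \<le> snd y + ell (Suc (fst y)) z then 1 else 0) \<partial>Mk)"

lemma jump_op_measurable [measurable]:
  assumes [measurable]: "h \<in> borel_measurable Sp"
  shows "jump_op h \<in> borel_measurable Sp"
proof -
  interpret prob_space Mk by (rule mark_prob)
  show ?thesis unfolding jump_op_def by measurable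
qed

lemma killed_op_measurable [measurable]:
  assumes [measurable]: "h \<in> borel_measurable Sp"
  shows "killed_op h \<in> borel_measurable Sp"
proof -
  interpret prob_space Mk by (rule mark_prob)
  show ?thesis unfolding killed_op_def by measurable
qed

lemma reset_prob_measurable [measurable]: "reset_prob \<in> borel_measurable Sp"
proof -
  interpret prob_space Mk by (rule mark_prob)
  show ?thesis unfolding reset_prob_def by measurable
qed

lemma killed_op_power_measurable [measurable]: "h \<in> borel_measurable Sp \<Longrightarrow> (killed_op ^^ k) h \<in> borel_measurable Sp"
  by (induction k) auto

text \<open>Split the marks according to whether they cause a reset. On a reset the new state is
  always \<open>(0, l)\<close>, so the value of \<open>h\<close> there factors out.\<close>

lemma jump_op_eq_killed_op:
  assumes [measurable]: "h \<in> borel_measurable Sp" "y \<in> space Sp"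
  shows "jump_op h y = killed_op h y + h (0, l) * reset_prob y"
proof -
  have "jump_op h y = (\<integral>\<^sup>+z. (if A \<le> snd y + ell (Suc (fst y)) z then 0 else h (J y z))
      + h (0, l) * (if A \<le> snd y + ell (Suc (fst y)) z then 1 else 0) \<partial>Mk)"
    unfolding jump_op_def by (intro nn_integral_cong) (auto simp: jump_eq)
  also have "\<dots> = killed_op h y + h (0, l) * reset_prob y"
    unfolding killed_op_def reset_prob_def
    by (subst nn_integral_add) (auto simp: nn_integral_cmult)
  finally show ?thesis .
qed

lemma jump_op_one: "jump_op (\<lambda>_. 1) y = 1"
  using prob_space.emeasure_space_1[OF mark_prob] by (simp add: jump_op_def)

abbreviation survives :: "nat \<times> real \<Rightarrow> (nat \<Rightarrow> real \<times> real) \<Rightarrow> nat \<Rightarrow> bool" where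
  "survives y \<omega> k \<equiv> (\<forall>j<k. \<not> is_reset 0 \<beta> l A ell y \<omega> j)"

lemma is_reset_eq:
  "is_reset 0 \<beta> l A ell y \<omega> k \<longleftrightarrow>
     A \<le> snd (X y \<omega> k) + ell (Suc (fst (X y \<omega> k))) (snd (\<omega> k))"
  by (simp add: is_reset_def pre_jump_def pre_jump_state_zero split: prod.splits)

lemma survives_case_nat:
  "survives y (case_nat s \<omega>) (Suc k) \<longleftrightarrow>
     \<not> A \<le> snd y + ell (Suc (fst y)) (snd s) \<and> survives (J y (snd s)) \<omega> k"
  unfolding All_less_Suc2 is_reset_eq post_jump_case_nat by simp

lemma measurable_reset [measurable (raw)]:
  assumes [measurable]: "f \<in> N \<rightarrow>\<^sub>M Sp" "g \<in> N \<rightarrow>\<^sub>M D"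
  shows "Measurable.pred N (\<lambda>x. is_reset 0 \<beta> l A ell (f x) (g x) k)"
  unfolding is_reset_eq by measurable

text \<open>Probabilistic meaning of the powers, by induction on \<open>k\<close> with one driving
  pair peeled off at a time. It makes linearity of the powers and their limits consequences of
  integration against the single measure \<open>D\<close>.\<close>

lemma killed_op_power_eq:
  assumes [measurable]: "h \<in> borel_measurable Sp" and "y \<in> space Sp"
  shows "(killed_op ^^ k) h y = (\<integral>\<^sup>+\<omega>. (if survives y \<omega> k then h (X y \<omega> k) else 0) \<partial>D)"
  using assms(2)
proof (induction k arbitrary: y)
  case 0
  interpret prob_space D by (rule prob_space_D)
  show ?case by (simp add: emeasure_space_1)
next
  case (Suc k)
  interpret Ed: prob_space Ed by (rule prob_space_exponential_density) simp
  have [measurable]: "y \<in> space Sp" by fact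
  let ?F = "\<lambda>\<omega>. if survives y \<omega> (Suc k) then h (X y \<omega> (Suc k)) else 0"
  have F: "?F (case_nat (e, z) \<omega>) = (if A \<le> snd y + ell (Suc (fst y)) z then 0
      else if survives (J y z) \<omega> k then h (X (J y z) \<omega> k) else 0)" for e z \<omega>
    unfolding survives_case_nat post_jump_case_nat by auto
  have "?F \<in> borel_measurable D"
    by measurable
  then have "(\<integral>\<^sup>+\<omega>. ?F \<omega> \<partial>D) = (\<integral>\<^sup>+e. \<integral>\<^sup>+z. \<integral>\<^sup>+\<omega>. (if A \<le> snd y + ell (Suc (fst y)) z then 0
      else if survives (J y z) \<omega> k then h (X (J y z) \<omega> k) else 0) \<partial>D \<partial>Mk \<partial>Ed)"
    by (subst nn_integral_D) (simp_all only: F)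
  also have "\<dots> = (\<integral>\<^sup>+e. killed_op ((killed_op ^^ k) h) y \<partial>Ed)"
    unfolding killed_op_def[of "(killed_op ^^ k) h"]
    by (intro nn_integral_cong) (simp add: Suc.IH jump_in_space[OF Suc.prems])
  also have "\<dots> = (killed_op ^^ Suc k) h y"
    using Ed.emeasure_space_1 by simp
  finally show ?case ..
qed

lemma killed_op_power_add:
  assumes [measurable]: "f \<in> borel_measurable Sp" "g \<in> borel_measurable Sp" and [simp]: "y \<in> space Sp"
  shows "(killed_op ^^ k) (\<lambda>y. f y + g y) y = (killed_op ^^ k) f y + (killed_op ^^ k) g y"
proof -
  have "(killed_op ^^ k) (\<lambda>y. f y + g y) y =
      (\<integral>\<^sup>+\<omega>. (if survives y \<omega> k then f (X y \<omega> k) else 0) + (if survives y \<omega> k then g (X y \<omega> k) else 0) \<partial>D)"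
    by (subst killed_op_power_eq) (auto intro!: nn_integral_cong)
  also have "\<dots> = (killed_op ^^ k) f y + (killed_op ^^ k) g y"
    by (subst nn_integral_add) (simp_all add: killed_op_power_eq assms)
  finally show ?thesis .
qed

lemma killed_op_power_cmult:
  assumes [measurable]: "f \<in> borel_measurable Sp" and [simp]: "y \<in> space Sp"
  shows "(killed_op ^^ k) (\<lambda>y. c * f y) y = c * (killed_op ^^ k) f y"
proof -
  have "(killed_op ^^ k) (\<lambda>y. c * f y) y = (\<integral>\<^sup>+\<omega>. c * (if survives y \<omega> k then f (X y \<omega> k) else 0) \<partial>D)"
    by (subst killed_op_power_eq) (auto intro!: nn_integral_cong)
  also have "\<dots> = c * (killed_op ^^ k) f y"
    by (subst nn_integral_cmult) (simp_all add: killed_op_power_eq assms)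
  finally show ?thesis .
qed

text \<open>A jump without reset raises the count by exactly one, so only the values at count
  \<open>Suc (fst y)\<close> are seen.\<close>

lemma killed_op_cong:
  assumes "y \<in> space Sp" "\<And>y'. y' \<in> space Sp \<Longrightarrow> fst y' = Suc (fst y) \<Longrightarrow> f y' = g y'"
  shows "killed_op f y = killed_op g y"
  unfolding killed_op_def
proof (intro nn_integral_cong if_cong refl)
  fix z assume "z \<in> space Mk" "\<not> A \<le> snd y + ell (Suc (fst y)) z"
  then show "f (J y z) = g (J y z)"
    using jump_in_space[OF assms(1), of z] by (intro assms(2)) (auto simp: jump_eq[of _ _ _ y z])
qed

lemma killed_op_power_cong:
  assumes "\<And>y. y \<in> space Sp \<Longrightarrow> f y = g y" "y \<in> space Sp"
  shows "(killed_op ^^ k) f y = (killed_op ^^ k) g y"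
  using assms(2) by (induction k arbitrary: y) (auto intro: killed_op_cong simp: assms)

text \<open>Along a surviving path the count is deterministic: after \<open>k\<close> jumps it is
  \<open>fst y + k\<close>. This is why count \<open>n\<close> in an excursion corresponds to a
  single step number.\<close>

lemma killed_op_power_count:
  assumes "y \<in> space Sp"
  shows "(killed_op ^^ k) (\<lambda>y'. if fst y' = m then h y' else 0) y = (if m = fst y + k then (killed_op ^^ k) h y else 0)"
  using assms
proof (induction k arbitrary: y)
  case (Suc k)
  have "killed_op ((killed_op ^^ k) (\<lambda>y'. if fst y' = m then h y' else 0)) y =
      killed_op (if m = fst y + Suc k then (killed_op ^^ k) h else (\<lambda>_. 0)) y"
    by (rule killed_op_cong[OF Suc.prems]) (simp add: Suc.IH)
  then show ?case by (simp add: killed_op_def[of "\<lambda>_. 0"])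
qed auto

section \<open>Certain reset and the occupation measure of an excursion\<close>

text \<open>The \<open>k\<close>-th power at the constant \<open>1\<close> is the probability of
  surviving \<open>k\<close> jumps. These events decrease to the event that no reset ever occurs,
  which is null by assumption.\<close>

lemma killed_op_power_one_tendsto:
  assumes "y \<in> space Sp"
    and "measure D {\<omega> \<in> space D. T_A 0 \<beta> l A ell y \<omega> < \<infinity>} = 1"
  shows "(\<lambda>k. (killed_op ^^ k) (\<lambda>_. 1) y) \<longlonglongrightarrow> 0"
proof -
  interpret prob_space D by (rule prob_space_D)
  note [measurable] = assms(1)
  let ?E = "\<lambda>k. {\<omega> \<in> space D. survives y \<omega> k}"
  let ?B = "{\<omega> \<in> space D. \<exists>k. is_reset 0 \<beta> l A ell y \<omega> k}"
  have E_sets: "?E k \<in> sets D" for k by measurable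
  have E: "(killed_op ^^ k) (\<lambda>_. 1) y = emeasure D (?E k)" for k
  proof -
    have "(killed_op ^^ k) (\<lambda>_. 1) y = (\<integral>\<^sup>+\<omega>. indicator (?E k) \<omega> \<partial>D)"
      unfolding killed_op_power_eq[OF borel_measurable_const assms(1)]
      by (intro nn_integral_cong) (simp split: split_indicator)
    then show ?thesis by (simp only: nn_integral_indicator[OF E_sets])
  qed
  \<comment> \<open>Jump times are real, and the infimum over the empty set is infinite; so
    finiteness of \<open>T_A\<close> says just that some jump is a reset.\<close>
  have "T_A 0 \<beta> l A ell y \<omega> < \<infinity> \<longleftrightarrow> (\<exists>k. is_reset 0 \<beta> l A ell y \<omega> k)" for \<omega>
    unfolding T_A_def INF_less_iff by auto
  then have "prob ?B = 1"
    using assms(2) by simp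
  moreover have "?B \<in> sets D"
    by measurable
  ultimately have "prob (space D - ?B) = 0"
    by (simp only: prob_compl)
  moreover have "(\<Inter>k. ?E k) = space D - ?B"
    by (auto intro: lessI)
  ultimately have null: "emeasure D (\<Inter>k. ?E k) = 0"
    by (simp only: emeasure_eq_measure ennreal_0)
  have "(\<lambda>k. emeasure D (?E k)) \<longlonglongrightarrow> emeasure D (\<Inter>k. ?E k)"
    by (intro Lim_emeasure_decseq) (use E_sets in \<open>auto simp: decseq_def\<close>)
  then show ?thesis unfolding E null .
qed

text \<open>The \<open>k\<close>-th summand is the probability that the first reset is the jump with
  index \<open>k\<close>. The sum telescopes, and its remainder, the survival probability, vanishes
  by \<open>lim\<close>.\<close>

lemma suminf_reset_prob:
  assumes [measurable]: "y \<in> space Sp" and lim: "(\<lambda>k. (killed_op ^^ k) (\<lambda>_. 1) y) \<longlonglongrightarrow> 0"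
  shows "(\<Sum>k. (killed_op ^^ k) reset_prob y) = 1"
proof -
  \<comment> \<open>The total mass \<open>1\<close> of a jump splits into survival and reset;
    applying the \<open>k\<close>-th power gives a telescoping identity without subtraction.\<close>
  have step: "(killed_op ^^ k) (\<lambda>_. 1) y = (killed_op ^^ Suc k) (\<lambda>_. 1) y + (killed_op ^^ k) reset_prob y" for k
  proof -
    have "(killed_op ^^ k) (\<lambda>_. 1) y = (killed_op ^^ k) (\<lambda>y. killed_op (\<lambda>_. 1) y + reset_prob y) y"
      using jump_op_eq_killed_op[of "\<lambda>_. 1"] by (intro killed_op_power_cong assms) (simp add: jump_op_one)
    also have "\<dots> = (killed_op ^^ k) (killed_op (\<lambda>_. 1)) y + (killed_op ^^ k) reset_prob y"
      by (intro killed_op_power_add) measurable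
    finally show ?thesis by (simp add: funpow_swap1)
  qed
  have partial: "(\<Sum>k<n. (killed_op ^^ k) reset_prob y) + (killed_op ^^ n) (\<lambda>_. 1) y = 1" for n
  proof (induction n)
    case (Suc n)
    then show ?case by (subst (asm) step) (simp add: ac_simps)
  qed simp
  have "(\<lambda>n. (\<Sum>k<n. (killed_op ^^ k) reset_prob y) + (killed_op ^^ n) (\<lambda>_. 1) y)
      \<longlonglongrightarrow> (\<Sum>k. (killed_op ^^ k) reset_prob y) + 0"
    by (intro tendsto_add lim summable_LIMSEQ) auto
  then show ?thesis
    unfolding partial by (auto simp: LIMSEQ_const_iff)
qed

text \<open>
  \<open>c\<close> times the expected number of visits of the embedded jump chain, started at \<open>(0, l)\<close>, before its
  first reset.
\<close>

definition chain_measure :: "ennreal \<Rightarrow> (nat \<times> real) measure" where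
  "chain_measure c = distr
     (density (count_space UNIV \<Otimes>\<^sub>M D) (\<lambda>(k, \<omega>). if survives (0, l) \<omega> k then c else 0))
     Sp (\<lambda>(k, \<omega>). X (0, l) \<omega> k)"

lemma sets_chain_measure [simp, measurable_cong]: "sets (chain_measure c) = sets Sp"
  by (simp add: chain_measure_def)

lemma nn_integral_chain_measure:
  assumes [measurable]: "h \<in> borel_measurable Sp"
  shows "(\<integral>\<^sup>+y. h y \<partial>chain_measure c) = (\<Sum>k. c * (killed_op ^^ k) h (0, l))"
proof -
  interpret prob_space D by (rule prob_space_D)
  have [measurable]: "(\<lambda>p. X (0, l) (snd p) (fst p)) \<in> count_space UNIV \<Otimes>\<^sub>M D \<rightarrow>\<^sub>M Sp"
    by (rule measurable_compose_countable[where g = fst and f = "\<lambda>k p. X (0, l) (snd p) k"]) measurable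
  have [measurable]: "Measurable.pred (count_space UNIV \<Otimes>\<^sub>M D) (\<lambda>p. survives (0, l) (snd p) (fst p))"
    by (rule measurable_compose_countable[where g = fst and f = "\<lambda>k p. survives (0, l) (snd p) k"]) measurable
  have "(\<integral>\<^sup>+y. h y \<partial>chain_measure c) = (\<integral>\<^sup>+p. (if survives (0, l) (snd p) (fst p) then c else 0)
      * h (X (0, l) (snd p) (fst p)) \<partial>(count_space UNIV \<Otimes>\<^sub>M D))"
    unfolding chain_measure_def case_prod_beta
    by (subst nn_integral_distr) (simp_all add: nn_integral_density)
  also have "\<dots> = (\<integral>\<^sup>+k. \<integral>\<^sup>+\<omega>. c * (if survives (0, l) \<omega> k then h (X (0, l) \<omega> k) else 0) \<partial>D \<partial>count_space UNIV)"
    by (subst nn_integral_fst[symmetric]) (auto intro!: nn_integral_cong)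
  also have "\<dots> = (\<Sum>k. c * (killed_op ^^ k) h (0, l))"
    by (simp add: nn_integral_count_space_nat nn_integral_cmult killed_op_power_eq start_in_space)
  finally show ?thesis .
qed

text \<open>Cycle argument: a jump without reset shifts the step number by one and so drops the
  contribution \<open>c * h (0, l)\<close> of step \<open>0\<close>. The resets return total mass
  \<open>c\<close> to \<open>(0, l)\<close>, which restores precisely this contribution.\<close>

lemma chain_measure_jump_op:
  assumes [measurable]: "h \<in> borel_measurable Sp"
    and lim: "(\<lambda>k. (killed_op ^^ k) (\<lambda>_. 1) (0, l)) \<longlonglongrightarrow> 0"
  shows "(\<integral>\<^sup>+y. jump_op h y \<partial>chain_measure c) = (\<integral>\<^sup>+y. h y \<partial>chain_measure c)"
proof -
  have "(killed_op ^^ k) (jump_op h) (0, l) = (killed_op ^^ Suc k) h (0, l) + h (0, l) * (killed_op ^^ k) reset_prob (0, l)" for k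
  proof -
    have "(killed_op ^^ k) (jump_op h) (0, l) = (killed_op ^^ k) (\<lambda>y. killed_op h y + h (0, l) * reset_prob y) (0, l)"
      by (intro killed_op_power_cong start_in_space jump_op_eq_killed_op) measurable
    also have "\<dots> = (killed_op ^^ k) (killed_op h) (0, l) + h (0, l) * (killed_op ^^ k) reset_prob (0, l)"
      by (simp add: killed_op_power_add killed_op_power_cmult start_in_space)
    finally show ?thesis by (simp add: funpow_swap1)
  qed
  then have "(\<integral>\<^sup>+y. jump_op h y \<partial>chain_measure c)
      = (\<Sum>k. c * (killed_op ^^ Suc k) h (0, l) + c * h (0, l) * (killed_op ^^ k) reset_prob (0, l))"
    by (simp only: nn_integral_chain_measure jump_op_measurable assms distrib_left mult.assoc)
  also have "\<dots> = (\<Sum>k. c * (killed_op ^^ Suc k) h (0, l)) + c * h (0, l) * (\<Sum>k. (killed_op ^^ k) reset_prob (0, l))"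
    by (simp add: suminf_add[symmetric] ennreal_suminf_cmult del: funpow.simps)
  also have "\<dots> = (\<Sum>k. c * (killed_op ^^ Suc k) h (0, l)) + c * h (0, l)"
    by (simp add: suminf_reset_prob[OF start_in_space lim])
  also have "\<dots> = (\<Sum>k. c * (killed_op ^^ k) h (0, l))"
    using suminf_offset[of "\<lambda>k. c * (killed_op ^^ k) h (0, l)" 1] by (simp add: add.commute)
  finally show ?thesis
    by (simp add: nn_integral_chain_measure)
qed

section \<open>Uniformised kernel and the candidate measure\<close>

text \<open>Thinning: potential jumps arrive at the constant rate \<open>A\<close>, and each is
  carried out with probability \<open>snd y / A\<close>.\<close>

definition unif_op :: "(nat \<times> real \<Rightarrow> ennreal) \<Rightarrow> nat \<times> real \<Rightarrow> ennreal" where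
  "unif_op h y = ennreal (snd y / A) * jump_op h y + ennreal (1 - snd y / A) * h y"

text \<open>The density is the mean holding time \<open>1 / snd y\<close>; it converts expected
  numbers of visits into expected time spent.\<close>

definition Pi_measure :: "ennreal \<Rightarrow> (nat \<times> real) measure" where
  "Pi_measure c = density (chain_measure c) (\<lambda>y. ennreal (1 / snd y))"

lemma sets_Pi_measure [simp, measurable_cong]: "sets (Pi_measure c) = sets Sp"
  by (simp add: Pi_measure_def)

lemma space_chain_measure [simp]: "space (chain_measure c) = space Sp"
  by (simp add: chain_measure_def)

lemma space_Pi_measure [simp]: "space (Pi_measure c) = space Sp"
  by (simp add: Pi_measure_def)

lemma unif_op_measurable [measurable]: "h \<in> borel_measurable Sp \<Longrightarrow> unif_op h \<in> borel_measurable Sp"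
  unfolding unif_op_def
  by (intro borel_measurable_add borel_measurable_times_ennreal measurable_compose[OF _ measurable_ennreal]
      borel_measurable_diff borel_measurable_divide borel_measurable_const measurable_snd_Sp jump_op_measurable)

lemma unif_op_power_measurable [measurable]: "h \<in> borel_measurable Sp \<Longrightarrow> (unif_op ^^ k) h \<in> borel_measurable Sp"
  by (induction k) auto

lemma nn_integral_Pi_measure:
  assumes [measurable]: "h \<in> borel_measurable Sp"
  shows "(\<integral>\<^sup>+y. h y \<partial>Pi_measure c) = (\<integral>\<^sup>+y. ennreal (1 / snd y) * h y \<partial>chain_measure c)"
  unfolding Pi_measure_def by (subst nn_integral_density) auto

text \<open>The weight \<open>1 / x\<close> cancels the state-dependent jump probability
  \<open>x / A\<close> up to the constant \<open>1 / A\<close>. The jump term is therefore governed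
  by invariance under the chain, and the remaining weight \<open>1 / x - 1 / A\<close> is
  nonnegative since \<open>x < A\<close>.\<close>

lemma Pi_measure_unif_op:
  assumes [measurable]: "h \<in> borel_measurable Sp"
    and lim: "(\<lambda>k. (killed_op ^^ k) (\<lambda>_. 1) (0, l)) \<longlonglongrightarrow> 0"
  shows "(\<integral>\<^sup>+y. unif_op h y \<partial>Pi_measure c) = (\<integral>\<^sup>+y. h y \<partial>Pi_measure c)"
proof -
  have coeff: "ennreal (1 / x) * ennreal (x / A) = ennreal (1 / A)"
      "ennreal (1 / x) * ennreal (1 - x / A) = ennreal (1 / x - 1 / A)"
      "ennreal (1 / A) + ennreal (1 / x - 1 / A) = ennreal (1 / x)"
    if "0 < x" "x < A" for x
    using that A_pos by (auto simp: ennreal_mult[symmetric] ennreal_plus[symmetric] field_simps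
        simp del: ennreal_plus)
  have "(\<integral>\<^sup>+y. unif_op h y \<partial>Pi_measure c) = (\<integral>\<^sup>+y. ennreal (1 / A) * jump_op h y + ennreal (1 / snd y - 1 / A) * h y \<partial>chain_measure c)"
    by (subst nn_integral_Pi_measure, measurable, unfold unif_op_def distrib_left mult.assoc[symmetric])
      (intro nn_integral_cong, simp add: coeff snd_pos)
  also have "\<dots> = (\<integral>\<^sup>+y. ennreal (1 / A) * h y + ennreal (1 / snd y - 1 / A) * h y \<partial>chain_measure c)"
    using chain_measure_jump_op[OF assms] by (simp add: nn_integral_add nn_integral_cmult)
  also have "\<dots> = (\<integral>\<^sup>+y. h y \<partial>Pi_measure c)"
    unfolding nn_integral_Pi_measure[OF assms(1)] distrib_right[symmetric]
    by (intro nn_integral_cong) (simp add: coeff snd_pos)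
  finally show ?thesis .
qed

lemma Pi_measure_unif_op_power:
  assumes [measurable]: "h \<in> borel_measurable Sp"
    and lim: "(\<lambda>k. (killed_op ^^ k) (\<lambda>_. 1) (0, l)) \<longlonglongrightarrow> 0"
  shows "(\<integral>\<^sup>+y. (unif_op ^^ k) h y \<partial>Pi_measure c) = (\<integral>\<^sup>+y. h y \<partial>Pi_measure c)"
  by (induction k) (simp_all add: Pi_measure_unif_op lim)

text \<open>Of the sum over step numbers that defines the occupation measure, the slice at count
  \<open>n\<close> retains only the term for step \<open>n\<close>.\<close>

lemma nn_integral_slice:
  assumes [measurable]: "g \<in> borel_measurable borel"
  shows "(\<integral>\<^sup>+x. g x \<partial>slice (Pi_measure c) n) = c * (killed_op ^^ n) (\<lambda>y. ennreal (1 / snd y) * g (snd y)) (0, l)"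
proof -
  let ?P = "Pi_measure c"
  have set: "({n} \<times> UNIV) \<inter> space ?P \<in> sets ?P"
  proof -
    have "{y \<in> space Sp. fst y = n} \<in> sets Sp" by measurable
    also have "{y \<in> space Sp. fst y = n} = ({n} \<times> UNIV) \<inter> space ?P"
      by auto
    finally show ?thesis by simp
  qed
  have [measurable]: "snd \<in> ?P \<rightarrow>\<^sub>M borel"
    by (simp add: measurable_cong_sets[OF sets_Pi_measure refl])
  have "(\<integral>\<^sup>+x. g x \<partial>slice ?P n) = (\<integral>\<^sup>+y. g (snd y) \<partial>restrict_space ?P ({n} \<times> UNIV))"
    unfolding slice_def by (subst nn_integral_distr) (auto intro: measurable_restrict_space1)
  also have "\<dots> = (\<integral>\<^sup>+y. g (snd y) * indicator ({n} \<times> UNIV) y \<partial>?P)"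
    by (rule nn_integral_restrict_space[OF set])
  also have "\<dots> = (\<integral>\<^sup>+y. (if fst y = n then g (snd y) else 0) \<partial>?P)"
    by (intro nn_integral_cong) (auto split: split_indicator)
  also have "\<dots> = (\<integral>\<^sup>+y. (if fst y = n then ennreal (1 / snd y) * g (snd y) else 0) \<partial>chain_measure c)"
    by (subst nn_integral_Pi_measure) (auto intro!: nn_integral_cong)
  also have "\<dots> = (\<Sum>k. c * (killed_op ^^ k) (\<lambda>y. if fst y = n then ennreal (1 / snd y) * g (snd y) else 0) (0, l))"
    by (intro nn_integral_chain_measure) measurable
  also have "\<dots> = c * (killed_op ^^ n) (\<lambda>y. ennreal (1 / snd y) * g (snd y)) (0, l)"
    by (subst suminf_finite[of "{n}"]) (auto simp: killed_op_power_count start_in_space)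
  finally show ?thesis .
qed

lemma sets_slice [simp]: "sets (slice \<mu> n) = sets borel"
  by (simp add: slice_def)

end

section \<open>Uniformisation and the backward equation\<close>

text \<open>The expectation of \<open>c\<close> at a Poisson variable of mean \<open>u\<close>, kept
  real-valued so that it can be differentiated in \<open>u\<close>.\<close>

definition poisson_mixture :: "(nat \<Rightarrow> real) \<Rightarrow> real \<Rightarrow> real" where
  "poisson_mixture c u = exp (- u) * (\<Sum>n. c n / fact n * u ^ n)"

lemma summable_poisson:
  fixes c :: "nat \<Rightarrow> real"
  assumes "\<And>n. 0 \<le> c n \<and> c n \<le> 1"
  shows "summable (\<lambda>n. c n / fact n * u ^ n)"
proof (rule summable_comparison_test'[OF summable_exp[of "\<bar>u\<bar>"]])
  show "norm (c n / fact n * u ^ n) \<le> inverse (fact n) * \<bar>u\<bar> ^ n" for n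
    using assms[of n] by (simp add: abs_mult power_abs divide_inverse mult_left_le_one_le mult.assoc)
qed

text \<open>Termwise differentiation of an exponential generating series shifts its coefficients;
  the factor \<open>exp (- u)\<close> contributes the subtracted term.\<close>

lemma poisson_mixture_deriv:
  assumes "\<And>n. 0 \<le> c n \<and> c n \<le> 1"
  shows "(poisson_mixture c has_real_derivative
     poisson_mixture (\<lambda>n. c (Suc n)) u - poisson_mixture c u) (at u)"
proof -
  have "((\<lambda>u. \<Sum>n. c n / fact n * u ^ n) has_real_derivative
      (\<Sum>n. diffs (\<lambda>n. c n / fact n) n * u ^ n)) (at u)"
    by (intro termdiffs_strong_converges_everywhere summable_poisson assms)
  moreover have "diffs (\<lambda>n. c n / fact n) = (\<lambda>n. c (Suc n) / fact n)"
    by (auto simp: diffs_def fact_Suc simp del: of_nat_Suc)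
  ultimately show ?thesis
    unfolding poisson_mixture_def[abs_def]
    by (auto intro!: derivative_eq_intros simp: algebra_simps)
qed

lemma poisson_mixture_add:
  assumes "\<And>n. 0 \<le> a n \<and> a n \<le> 1" "\<And>n. 0 \<le> b n \<and> b n \<le> 1"
  shows "poisson_mixture (\<lambda>n. p * a n + q * b n) u = p * poisson_mixture a u + q * poisson_mixture b u"
proof -
  have "(\<lambda>n. p * (a n / fact n * u ^ n) + q * (b n / fact n * u ^ n)) sums
      (p * (\<Sum>n. a n / fact n * u ^ n) + q * (\<Sum>n. b n / fact n * u ^ n))"
    by (intro sums_add sums_mult summable_sums summable_poisson assms)
  moreover have "(p * a n + q * b n) / fact n * u ^ n = p * (a n / fact n * u ^ n) + q * (b n / fact n * u ^ n)" for n
    by (simp add: field_simps)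
  ultimately show ?thesis
    by (simp add: poisson_mixture_def sums_iff distrib_left mult.left_commute)
qed

lemma poisson_mixture_0: "poisson_mixture c 0 = c 0"
proof -
  have "(\<Sum>n. c n / fact n * 0 ^ n) = (\<Sum>n\<in>{0}. c n / fact n * 0 ^ n)"
    by (rule suminf_finite) auto
  then show ?thesis by (simp add: poisson_mixture_def)
qed

lemma poisson_mixture_nonneg:
  assumes "\<And>n. 0 \<le> c n \<and> c n \<le> 1" "0 \<le> u"
  shows "0 \<le> poisson_mixture c u"
  unfolding poisson_mixture_def using assms
  by (intro mult_nonneg_nonneg suminf_nonneg summable_poisson) auto

lemma poisson_mixture_measurable [measurable]:
  assumes "\<And>n. 0 \<le> c n \<and> c n \<le> 1"
  shows "poisson_mixture c \<in> borel_measurable borel"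
  using poisson_mixture_deriv[of c, OF assms]
  by (intro borel_measurable_continuous_onI continuous_at_imp_continuous_on)
     (auto intro: DERIV_isCont)

text \<open>\<open>- exp (- e) * poisson_mixture a (A * (t - e / x))\<close> is an antiderivative of the integrand.\<close>

lemma poisson_mixture_backward:
  assumes a: "\<And>n. 0 \<le> a n \<and> a n \<le> 1" and b: "\<And>n. 0 \<le> b n \<and> b n \<le> 1"
    and step: "\<And>n. a (Suc n) = x / A * b n + (1 - x / A) * a n"
    and pos: "0 < x" "0 < A" "0 \<le> t"
  shows "(\<integral>\<^sup>+e. ennreal (exp (- e) * poisson_mixture b (A * (t - e / x))) * indicator {0..t * x} e \<partial>lborel)
    + ennreal (exp (- (t * x)) * a 0) = ennreal (poisson_mixture a (A * t))"
proof -
  \<comment> \<open>The recurrence for \<open>a\<close> turns the derivative of its mixture into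
    \<open>x / A\<close> times a difference of mixtures; the inner derivative
    \<open>- (A / x)\<close> of the time argument cancels this factor.\<close>
  have Suc: "poisson_mixture (\<lambda>n. a (Suc n)) u - poisson_mixture a u =
      x / A * (poisson_mixture b u - poisson_mixture a u)" for u
    unfolding step poisson_mixture_add[OF b a] by (simp add: algebra_simps)
  let ?F = "\<lambda>e. - exp (- e) * poisson_mixture a (A * (t - e / x))"
  have deriv: "(?F has_real_derivative exp (- e) * poisson_mixture b (A * (t - e / x))) (at e)" for e
  proof -
    let ?u = "A * (t - e / x)"
    have "((\<lambda>e. A * (t - e / x)) has_real_derivative - (A / x)) (at e)"
      using pos by (auto intro!: derivative_eq_intros)
    from DERIV_chain2[OF poisson_mixture_deriv[of a, OF a] this]
    have "((\<lambda>e. poisson_mixture a (A * (t - e / x))) has_real_derivative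
        x / A * (poisson_mixture b ?u - poisson_mixture a ?u) * (- (A / x))) (at e)"
      unfolding Suc .
    moreover have "x / A * (poisson_mixture b ?u - poisson_mixture a ?u) * (- (A / x)) =
        poisson_mixture a ?u - poisson_mixture b ?u"
      using pos by simp
    ultimately have "((\<lambda>e. poisson_mixture a (A * (t - e / x))) has_real_derivative
        poisson_mixture a ?u - poisson_mixture b ?u) (at e)"
      by simp
    then have "((\<lambda>e. exp (- e) * poisson_mixture a (A * (t - e / x))) has_real_derivative
        - exp (- e) * poisson_mixture a ?u + (poisson_mixture a ?u - poisson_mixture b ?u) * exp (- e)) (at e)"
      by (intro DERIV_mult) (auto intro!: derivative_eq_intros)
    from DERIV_minus[OF this] show ?thesis
      by (simp add: algebra_simps)
  qed
  have nonneg: "0 \<le> exp (- e) * poisson_mixture b (A * (t - e / x))" if "e \<le> t * x" for e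
    using pos that by (intro mult_nonneg_nonneg poisson_mixture_nonneg b) (auto simp: field_simps)
  \<comment> \<open>The integral is \<open>ennreal\<close> of \<open>?F (t * x) - ?F 0\<close>. Only
    once this difference is known to be nonnegative can the boundary term at \<open>t * x\<close>,
    where the mixture has argument \<open>0\<close>, be added inside \<open>ennreal\<close>.\<close>
  have "?F 0 \<le> ?F (t * x)"
  proof (rule DERIV_nonneg_imp_nondecreasing[of 0 "t * x" ?F])
    show "0 \<le> t * x" using pos by simp
    show "\<exists>d. (?F has_real_derivative d) (at e) \<and> 0 \<le> d" if "0 \<le> e" "e \<le> t * x" for e
      using deriv[of e] nonneg[OF that(2)] by blast
  qed
  moreover have "(\<lambda>e. exp (- e) * poisson_mixture b (A * (t - e / x))) \<in> borel_measurable borel"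
    using poisson_mixture_measurable[of b, OF b] by measurable
  then have "(\<integral>\<^sup>+e. ennreal (exp (- e) * poisson_mixture b (A * (t - e / x))) * indicator {0..t * x} e \<partial>lborel)
      = ennreal (?F (t * x) - ?F 0)"
    using pos by (intro nn_integral_FTC_Icc deriv nonneg) auto
  ultimately show ?thesis
    using pos a[of 0] by (simp add: poisson_mixture_0 ennreal_plus[symmetric] del: ennreal_plus)
qed

section \<open>Integrals against the exponential law\<close>

lemma nn_integral_exponential_split:
  assumes [measurable]: "g \<in> borel_measurable borel" and "0 \<le> a"
  shows "(\<integral>\<^sup>+e. (if a < e then c else g e) \<partial>density lborel (\<lambda>e. ennreal (exponential_density 1 e))) =
    (\<integral>\<^sup>+e. ennreal (exp (- e)) * g e * indicator {0..a} e \<partial>lborel) + c * ennreal (exp (- a))"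
proof -
  have tail: "(\<integral>\<^sup>+e. ennreal (exp (- e)) * indicator {a..} e \<partial>lborel) = ennreal (0 - (- exp (- a)))"
  proof (rule nn_integral_FTC_atLeast)
    show "((\<lambda>e::real. - exp (- e)) \<longlongrightarrow> 0) at_top"
      by real_asymp
  qed (auto intro!: derivative_eq_intros)
  have "(\<integral>\<^sup>+e. (if a < e then c else g e) \<partial>density lborel (\<lambda>e. ennreal (exponential_density 1 e))) =
      (\<integral>\<^sup>+e. ennreal (exponential_density 1 e) * (if a < e then c else g e) \<partial>lborel)"
    by (rule nn_integral_density) measurable
  also have "\<dots> = (\<integral>\<^sup>+e. ennreal (exp (- e)) * g e * indicator {0..a} e
      + c * (ennreal (exp (- e)) * indicator {a..} e) \<partial>lborel)"
    \<comment> \<open>The point \<open>a\<close> lies in both indicator sets, so the integrands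
      agree only off this null point.\<close>
    using AE_lborel_singleton[of a]
    by (intro nn_integral_cong_AE, elim eventually_mono)
       (use \<open>0 \<le> a\<close> in \<open>auto simp: exponential_density_def ac_simps split: split_indicator\<close>)
  also have "\<dots> = (\<integral>\<^sup>+e. ennreal (exp (- e)) * g e * indicator {0..a} e \<partial>lborel) + c * ennreal (exp (- a))"
    by (subst nn_integral_add) (simp_all add: nn_integral_cmult tail)
  finally show ?thesis .
qed

lemma nn_integral_exponential_initial:
  assumes "0 \<le> a"
  shows "(\<integral>\<^sup>+e. (if a < e then 0 else c) \<partial>density lborel (\<lambda>e. ennreal (exponential_density 1 e))) =
    c * ennreal (1 - exp (- a))"
proof -
  have "(\<integral>\<^sup>+e. ennreal (exp (- e)) * indicator {0..a} e \<partial>lborel) = ennreal (- exp (- a) - (- exp (- 0)))"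
    using assms by (intro nn_integral_FTC_Icc) (auto intro!: derivative_eq_intros)
  then show ?thesis
    using assms by (subst nn_integral_exponential_split) (simp_all add: mult.assoc nn_integral_cmult mult.left_commute[of _ c])
qed

lemma suminf_poisson:
  assumes "0 \<le> s"
  shows "(\<Sum>n. ennreal (exp (- s) * s ^ n / fact n)) = 1"
proof -
  have "(\<lambda>n. exp (- s) * (s ^ n /\<^sub>R fact n)) sums (exp (- s) * exp s)"
    by (intro sums_mult exp_converges)
  then have "(\<lambda>n. exp (- s) * s ^ n / fact n) sums 1"
    by (simp add: divide_inverse mult_ac exp_minus)
  then show ?thesis
    using assms by (subst suminf_ennreal2) (auto simp: sums_iff)
qed

lemma convex_le_1:
  fixes u v :: ennreal
  assumes "u \<le> 1" "v \<le> 1" "0 \<le> p" "p \<le> 1"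
  shows "ennreal p * u + ennreal (1 - p) * v \<le> 1"
proof -
  have "ennreal p * u + ennreal (1 - p) * v \<le> ennreal p * 1 + ennreal (1 - p) * 1"
    by (intro add_mono mult_left_mono assms) auto
  also have "\<dots> = 1"
    using assms by (simp add: ennreal_plus[symmetric] del: ennreal_plus)
  finally show ?thesis .
qed

section \<open>Backward equation: uniqueness and the uniformised solution\<close>

context resetting_process
begin

definition unif_semigroup :: "(nat \<times> real \<Rightarrow> ennreal) \<Rightarrow> real \<Rightarrow> nat \<times> real \<Rightarrow> ennreal" where
  "unif_semigroup h t y = (\<Sum>n. ennreal (exp (- (A * t)) * (A * t) ^ n / fact n) * (unif_op ^^ n) h y)"

text \<open>The integrand of the first-jump equation as a function of the first exponential variable
  \<open>e\<close>: there is no jump by time \<open>t\<close> if \<open>e\<close> exceeds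
  \<open>t * snd y\<close>; otherwise the remaining time starts afresh after a jump. The maximum
  matches \<open>waiting_time_zero\<close>.\<close>

definition backward_rhs ::
  "(nat \<times> real \<Rightarrow> ennreal) \<Rightarrow> (real \<Rightarrow> nat \<times> real \<Rightarrow> ennreal) \<Rightarrow> real \<Rightarrow> nat \<times> real \<Rightarrow> real \<Rightarrow> ennreal" where
  "backward_rhs h f t y e = (if t * snd y < e then h y else jump_op (f (t - max 0 (e / snd y))) y)"

definition backward_solution ::
  "(nat \<times> real \<Rightarrow> ennreal) \<Rightarrow> (real \<Rightarrow> nat \<times> real \<Rightarrow> ennreal) \<Rightarrow> bool" where
  "backward_solution h f \<longleftrightarrow> (\<forall>t\<ge>0. f t \<in> borel_measurable Sp \<and> (\<forall>y\<in>space Sp. f t y \<le> 1 \<and>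
     backward_rhs h f t y \<in> borel_measurable borel \<and> f t y = (\<integral>\<^sup>+e. backward_rhs h f t y e \<partial>Ed)))"

lemma jump_op_mono:
  assumes "y \<in> space Sp" "\<And>y. y \<in> space Sp \<Longrightarrow> f y \<le> g y"
  shows "jump_op f y \<le> jump_op g y"
  unfolding jump_op_def by (intro nn_integral_mono assms jump_in_space)

lemma jump_op_add_const:
  assumes [measurable]: "f \<in> borel_measurable Sp" "y \<in> space Sp"
  shows "jump_op (\<lambda>y. f y + c) y = jump_op f y + c"
proof -
  interpret Mk: prob_space Mk by (rule mark_prob)
  show ?thesis
    unfolding jump_op_def by (subst nn_integral_add) (simp_all add: Mk.emeasure_space_1)
qed

text \<open>Two solutions can differ only if the first jump occurs before \<open>s\<close>, which
  has probability at most \<open>1 - exp (- (t * A))\<close> because the intensity is below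
  \<open>A\<close>. The bound is one-sided and additive, which avoids differences in
  \<open>ennreal\<close>.\<close>

lemma backward_contraction:
  assumes f: "backward_solution h f" and g: "backward_solution h g"
    and le: "\<And>s y. 0 \<le> s \<Longrightarrow> s \<le> t \<Longrightarrow> y \<in> space Sp \<Longrightarrow> f s y \<le> g s y + c"
    and s: "0 \<le> s" "s \<le> t" and y: "y \<in> space Sp"
  shows "f s y \<le> g s y + c * ennreal (1 - exp (- (t * A)))"
proof -
  note pos = snd_pos[OF y]
  have [measurable]: "backward_rhs h g s y \<in> borel_measurable borel"
    using g s y by (auto simp: backward_solution_def)
  have "backward_rhs h f s y e \<le> backward_rhs h g s y e + (if s * snd y < e then 0 else c)" for e
  proof (cases "s * snd y < e")
    case False
    then have r: "0 \<le> s - max 0 (e / snd y)" "s - max 0 (e / snd y) \<le> t"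
      using pos s by (auto simp: field_simps)
    have "jump_op (f (s - max 0 (e / snd y))) y \<le> jump_op (\<lambda>y'. g (s - max 0 (e / snd y)) y' + c) y"
      by (intro jump_op_mono y le r)
    also have "\<dots> = jump_op (g (s - max 0 (e / snd y))) y + c"
      using g r by (intro jump_op_add_const y) (auto simp: backward_solution_def)
    finally show ?thesis using False by (simp add: backward_rhs_def)
  qed (simp add: backward_rhs_def)
  then have "(\<integral>\<^sup>+e. backward_rhs h f s y e \<partial>Ed) \<le>
      (\<integral>\<^sup>+e. backward_rhs h g s y e + (if s * snd y < e then 0 else c) \<partial>Ed)"
    by (intro nn_integral_mono) simp
  also have "\<dots> = (\<integral>\<^sup>+e. backward_rhs h g s y e \<partial>Ed) + c * ennreal (1 - exp (- (s * snd y)))"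
    using pos s by (subst nn_integral_add) (simp_all add: nn_integral_exponential_initial)
  also have "\<dots> \<le> (\<integral>\<^sup>+e. backward_rhs h g s y e \<partial>Ed) + c * ennreal (1 - exp (- (t * A)))"
    using pos s by (intro add_left_mono mult_left_mono ennreal_leI) (auto intro!: mult_mono)
  finally show ?thesis
    using f g s y by (auto simp: backward_solution_def)
qed

text \<open>The bound by \<open>1\<close> built into \<open>backward_solution\<close> starts the
  iteration, each contraction supplies a factor \<open>q\<close>, and \<open>q < 1\<close> makes the
  error vanish. Uniqueness follows by symmetry.\<close>

lemma backward_le:
  assumes f: "backward_solution h f" and g: "backward_solution h g"
    and t: "0 \<le> t" and y: "y \<in> space Sp"
  shows "f t y \<le> g t y"
proof -
  define q where "q = 1 - exp (- (t * A))"
  have q: "0 \<le> q" "q < 1"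
    using t A_pos by (auto simp: q_def)
  have "f s y \<le> g s y + ennreal (q ^ n)" if "0 \<le> s" "s \<le> t" "y \<in> space Sp" for n s y
    using that
  proof (induction n arbitrary: s y)
    case 0
    then have "f s y \<le> 1" using f unfolding backward_solution_def by blast
    then show ?case by (simp add: add_increasing)
  next
    case (Suc n)
    have "ennreal (q ^ n) * ennreal (1 - exp (- (t * A))) = ennreal (q ^ Suc n)"
      using q unfolding q_def[symmetric] by (simp add: ennreal_mult mult.commute)
    with backward_contraction[OF f g Suc.IH Suc.prems] show ?case
      by simp
  qed
  then have "f t y \<le> g t y + ennreal (q ^ n)" for n
    using t y by simp
  moreover have "(\<lambda>n. g t y + ennreal (q ^ n)) \<longlonglongrightarrow> g t y + ennreal 0"
    using q by (intro tendsto_add tendsto_const tendsto_ennrealI LIMSEQ_realpow_zero)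
  ultimately show ?thesis
    by (intro LIMSEQ_le_const[of "\<lambda>n. g t y + ennreal (q ^ n)"]) auto
qed

lemma backward_unique:
  assumes "backward_solution h f" "backward_solution h g" "0 \<le> t" "y \<in> space Sp"
  shows "f t y = g t y"
  using assms by (intro antisym backward_le)

lemma jump_op_le_1:
  assumes "\<And>y. y \<in> space Sp \<Longrightarrow> h y \<le> 1" "y \<in> space Sp"
  shows "jump_op h y \<le> 1"
  using jump_op_mono[OF assms(2), of h "\<lambda>_. 1"] assms(1) by (simp add: jump_op_one)

lemma unif_op_power_le_1:
  assumes "\<And>y. y \<in> space Sp \<Longrightarrow> h y \<le> 1" "y \<in> space Sp"
  shows "(unif_op ^^ n) h y \<le> 1"
  using assms(2)
proof (induction n arbitrary: y)
  case (Suc n)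
  then show ?case
    using snd_pos[OF Suc.prems] unfolding funpow.simps comp_def unif_op_def[of "(unif_op ^^ n) h"]
    by (intro convex_le_1 jump_op_le_1 Suc.IH) auto
qed (simp add: assms)

text \<open>Values bounded by \<open>1\<close> are finite, so the series passes from
  \<open>ennreal\<close> to the reals, where the calculus of Poisson mixtures applies.\<close>

lemma suminf_poisson_mixture:
  assumes "\<And>n. u n \<le> 1" "0 \<le> s"
  shows "(\<Sum>n. ennreal (exp (- s) * s ^ n / fact n) * u n) = ennreal (poisson_mixture (\<lambda>n. enn2real (u n)) s)"
proof -
  have u: "0 \<le> enn2real (u n) \<and> enn2real (u n) \<le> 1" for n
    using enn2real_mono[OF assms(1)[of n]] by simp
  have "ennreal (exp (- s) * s ^ n / fact n) * u n = ennreal (exp (- s) * (enn2real (u n) / fact n * s ^ n))" for n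
  proof -
    have "u n = ennreal (enn2real (u n))"
      using le_less_trans[OF assms(1)[of n], of top] by (simp add: less_top)
    then show ?thesis
      using u[of n] assms(2) ennreal_mult[of "exp (- s) * s ^ n / fact n" "enn2real (u n)"]
      by (simp add: mult_ac)
  qed
  then have "(\<Sum>n. ennreal (exp (- s) * s ^ n / fact n) * u n) =
      (\<Sum>n. ennreal (exp (- s) * (enn2real (u n) / fact n * s ^ n)))"
    by (simp only:)
  also have "\<dots> = ennreal (\<Sum>n. exp (- s) * (enn2real (u n) / fact n * s ^ n))"
    using assms(2) by (intro suminf_ennreal2 summable_mult summable_poisson u) auto
  also have "\<dots> = ennreal (poisson_mixture (\<lambda>n. enn2real (u n)) s)"
    unfolding poisson_mixture_def
    by (simp only: suminf_mult[OF summable_poisson[of "\<lambda>n. enn2real (u n)", OF u]])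
  finally show ?thesis .
qed

lemma jump_op_unif_semigroup:
  assumes [measurable]: "h \<in> borel_measurable Sp" "y \<in> space Sp"
  shows "jump_op (unif_semigroup h t) y = (\<Sum>n. ennreal (exp (- (A * t)) * (A * t) ^ n / fact n) * jump_op ((unif_op ^^ n) h) y)"
  unfolding jump_op_def unif_semigroup_def
  by (subst nn_integral_suminf) (simp_all add: nn_integral_cmult)

text \<open>For a fixed state the powers of \<open>unif_op\<close> and their images under
  \<open>jump_op\<close> form two real sequences linked by the recurrence of
  \<open>poisson_mixture_backward\<close>. The backward equation is that lemma with
  \<open>x = snd y\<close>, rewritten as an exponential integral.\<close>

lemma backward_solution_unif_semigroup:
  assumes [measurable]: "h \<in> borel_measurable Sp" and le: "\<And>y. y \<in> space Sp \<Longrightarrow> h y \<le> 1"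
  shows "backward_solution h (unif_semigroup h)"
  unfolding backward_solution_def
proof (intro allI impI conjI ballI)
  fix t :: real assume t: "0 \<le> t"
  show "unif_semigroup h t \<in> borel_measurable Sp"
    unfolding unif_semigroup_def by measurable
  fix y assume y [measurable]: "y \<in> space Sp"
  note pos = snd_pos[OF y]
  define a where "a n = enn2real ((unif_op ^^ n) h y)" for n
  define b where "b n = enn2real (jump_op ((unif_op ^^ n) h) y)" for n
  have a_le: "(unif_op ^^ n) h y \<le> 1" and b_le: "jump_op ((unif_op ^^ n) h) y \<le> 1" for n
    by (auto intro!: unif_op_power_le_1 jump_op_le_1 le y)
  have a: "0 \<le> a n \<and> a n \<le> 1" and b: "0 \<le> b n \<and> b n \<le> 1" for n
    using enn2real_mono[OF a_le[of n]] enn2real_mono[OF b_le[of n]] by (auto simp: a_def b_def)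
  have ea: "(unif_op ^^ n) h y = ennreal (a n)" and eb: "jump_op ((unif_op ^^ n) h) y = ennreal (b n)" for n
    using le_less_trans[OF a_le[of n], of top] le_less_trans[OF b_le[of n], of top]
    by (simp_all add: less_top a_def b_def)
  have step: "a (Suc n) = snd y / A * b n + (1 - snd y / A) * a n" for n
  proof -
    have "ennreal (a (Suc n)) = ennreal (snd y / A) * jump_op ((unif_op ^^ n) h) y + ennreal (1 - snd y / A) * (unif_op ^^ n) h y"
      by (simp add: ea[symmetric] unif_op_def)
    also have "\<dots> = ennreal (snd y / A * b n + (1 - snd y / A) * a n)"
      using pos a[of n] b[of n] A_pos by (simp add: ea eb ennreal_mult ennreal_plus del: times_divide_eq_left)
    finally show ?thesis
      using pos a[of n] b[of n] a[of "Suc n"] A_pos by (subst (asm) ennreal_inj) auto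
  qed
  have semigroup: "unif_semigroup h s y = ennreal (poisson_mixture a (A * s))" and jump_semigroup: "jump_op (unif_semigroup h s) y = ennreal (poisson_mixture b (A * s))"
    if "0 \<le> s" for s
    using suminf_poisson_mixture[of "\<lambda>n. (unif_op ^^ n) h y" "A * s"] 
      suminf_poisson_mixture[of "\<lambda>n. jump_op ((unif_op ^^ n) h) y" "A * s"] a_le b_le A_pos that
    by (simp_all add: unif_semigroup_def jump_op_unif_semigroup a_def[abs_def] b_def[abs_def] y)
  let ?g = "\<lambda>e. ennreal (poisson_mixture b (A * (t - max 0 (e / snd y))))"
  have g [measurable]: "?g \<in> borel_measurable borel"
    using poisson_mixture_measurable[of b, OF b] by measurable
  have rhs: "backward_rhs h (unif_semigroup h) t y = (\<lambda>e. if t * snd y < e then h y else ?g e)"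
  proof
    fix e
    have "0 \<le> t - max 0 (e / snd y)" if "\<not> t * snd y < e"
      using that pos t by (simp add: field_simps)
    then show "backward_rhs h (unif_semigroup h) t y e = (if t * snd y < e then h y else ?g e)"
      using jump_semigroup[of "t - max 0 (e / snd y)"] by (simp add: backward_rhs_def)
  qed
  show "backward_rhs h (unif_semigroup h) t y \<in> borel_measurable borel"
    unfolding rhs by measurable
  have "(\<integral>\<^sup>+e. backward_rhs h (unif_semigroup h) t y e \<partial>Ed) =
      (\<integral>\<^sup>+e. ennreal (exp (- e)) * ?g e * indicator {0..t * snd y} e \<partial>lborel) + h y * ennreal (exp (- (t * snd y)))"
    unfolding rhs using pos t by (intro nn_integral_exponential_split g) simp
  \<comment> \<open>The indicator forces \<open>e\<close> to be nonnegative, so the maximum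
    disappears.\<close>
  also have "(\<integral>\<^sup>+e. ennreal (exp (- e)) * ?g e * indicator {0..t * snd y} e \<partial>lborel) =
      (\<integral>\<^sup>+e. ennreal (exp (- e) * poisson_mixture b (A * (t - e / snd y))) * indicator {0..t * snd y} e \<partial>lborel)"
    using pos by (intro nn_integral_cong) (auto simp: ennreal_mult' max_def split: split_indicator)
  also have "\<dots> + h y * ennreal (exp (- (t * snd y))) = ennreal (poisson_mixture a (A * t))"
    using poisson_mixture_backward[of a b "snd y" A t, OF a b step] ea[of 0] a[of 0] pos t A_pos
    by (simp add: ennreal_mult mult.commute)
  finally show "unif_semigroup h t y = (\<integral>\<^sup>+e. backward_rhs h (unif_semigroup h) t y e \<partial>Ed)"
    using semigroup[OF t] by simp
  show "unif_semigroup h t y \<le> 1"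
  proof -
    have "poisson_mixture a (A * t) \<le> exp (- (A * t)) * (\<Sum>n. 1 / fact n * (A * t) ^ n)"
      unfolding poisson_mixture_def using a t A_pos
      by (intro mult_left_mono suminf_le summable_poisson mult_right_mono divide_right_mono) auto
    also have "\<dots> = 1"
      using exp_converges[of "A * t"] by (simp add: sums_iff divide_inverse mult.commute exp_minus)
    finally show ?thesis using semigroup[OF t] by simp
  qed
qed

text \<open>Excluding the paths that explode before \<open>t\<close>, on which \<open>Y\<close> is arbitrary.\<close>

definition nonexploding_law :: "(nat \<times> real \<Rightarrow> ennreal) \<Rightarrow> real \<Rightarrow> nat \<times> real \<Rightarrow> ennreal" where
  "nonexploding_law h t y = (\<integral>\<^sup>+\<omega>. (if \<exists>k. t < T y \<omega> (Suc k) then h (Y 0 \<beta> l A ell y t \<omega>) else 0) \<partial>D)"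

section \<open>Law of the process at a fixed time\<close>

lemma Y_measurable [measurable (raw)]:
  assumes [measurable]: "f \<in> borel_measurable N" "g \<in> N \<rightarrow>\<^sub>M Sp" "w \<in> N \<rightarrow>\<^sub>M D"
  shows "(\<lambda>x. Y 0 \<beta> l A ell (g x) (f x) (w x)) \<in> N \<rightarrow>\<^sub>M Sp"
  unfolding Y_zero
proof (rule measurable_compose_countable[where f = "\<lambda>k x. X (g x) (w x) k"])
  show "(\<lambda>x. LEAST k. f x < T (g x) (w x) (Suc k)) \<in> N \<rightarrow>\<^sub>M count_space UNIV"
    by measurable
qed measurable

lemma nonexploding_law_measurable [measurable (raw)]:
  assumes [measurable]: "h \<in> borel_measurable Sp" "f \<in> borel_measurable N" "g \<in> N \<rightarrow>\<^sub>M Sp"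
  shows "(\<lambda>x. nonexploding_law h (f x) (g x)) \<in> borel_measurable N"
proof -
  interpret D: prob_space D by (rule prob_space_D)
  show ?thesis unfolding nonexploding_law_def by measurable
qed

text \<open>Renewal at the first waiting time \<open>w\<close>: if it exceeds \<open>t\<close>, the
  process is still at \<open>y\<close>; otherwise the path restarts from \<open>J y z\<close> with
  time \<open>t - w\<close> left. The statement covers exploding paths too, since explosion before
  \<open>t\<close> is equivalent to explosion of the restarted path before
  \<open>t - w\<close>.\<close>

lemma first_jump:
  fixes e :: real
  assumes "0 < snd y"
  defines "w \<equiv> max 0 (e / snd y)"
  shows "(if \<exists>k. t < T y (case_nat (e, z) \<omega>) (Suc k) then h (Y 0 \<beta> l A ell y t (case_nat (e, z) \<omega>)) else 0) =
    (if t < w then h y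
     else if \<exists>k. t - w < T (J y z) \<omega> (Suc k) then h (Y 0 \<beta> l A ell (J y z) (t - w) \<omega>) else (0 :: ennreal))"
proof -
  let ?P = "\<lambda>k. t < T y (case_nat (e, z) \<omega>) (Suc k)" and ?P' = "\<lambda>k. t - w < T (J y z) \<omega> (Suc k)"
  have T: "T y (case_nat (e, z) \<omega>) (Suc k) = w + T (J y z) \<omega> k" for k
    using waiting_time_zero[OF assms(1)] by (simp add: jump_time_case_nat w_def)
  have P0: "?P 0 \<longleftrightarrow> t < w"
    by (simp add: T jump_time_def[of _ _ _ _ _ _ _ 0])
  have PSuc: "?P (Suc k) \<longleftrightarrow> ?P' k" for k
    by (auto simp: T)
  show ?thesis
  proof (cases "t < w")
    case True
    then have "(LEAST k. ?P k) = 0"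
      using P0 by (intro Least_equality) auto
    moreover have "\<exists>k. ?P k"
      using True P0 by blast
    ultimately show ?thesis using True by (simp add: Y_zero)
  next
    case False
    have ex: "(\<exists>k. ?P k) \<longleftrightarrow> (\<exists>k. ?P' k)"
      using P0 PSuc False by (metis not0_implies_Suc)
    show ?thesis
    proof (cases "\<exists>k. ?P k")
      case True
      then obtain k where "?P k" ..
      \<comment> \<open>With at least one jump by time \<open>t\<close>, the jump count of the full
        path is one more than that of the restarted path.\<close>
      then have "(LEAST k. ?P k) = Suc (LEAST k. ?P (Suc k))"
        using False P0 by (intro Least_Suc) auto
      then have "Y 0 \<beta> l A ell y t (case_nat (e, z) \<omega>) = Y 0 \<beta> l A ell (J y z) (t - w) \<omega>"
        unfolding Y_zero PSuc by (simp only: post_jump_case_nat snd_conv)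
      then show ?thesis
        using True False ex by (simp only: if_True if_False)
    next
      case False
      then show ?thesis
        using \<open>\<not> t < w\<close> ex by (simp only: if_False)
    qed
  qed
qed

text \<open>Integrate \<open>first_jump\<close> over the first exponential variable, the first mark
  and the remaining sequence; the innermost integral is the same law at the remaining time.\<close>

lemma backward_solution_nonexploding_law:
  assumes [measurable]: "h \<in> borel_measurable Sp" and le: "\<And>y. y \<in> space Sp \<Longrightarrow> h y \<le> 1"
  shows "backward_solution h (nonexploding_law h)"
  unfolding backward_solution_def
proof (intro allI impI conjI ballI)
  interpret D: prob_space D by (rule prob_space_D)
  interpret Mk: prob_space Mk by (rule mark_prob)
  fix t :: real assume t: "0 \<le> t"
  show "nonexploding_law h t \<in> borel_measurable Sp"
    by measurable
  fix y assume y [measurable]: "y \<in> space Sp"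
  note pos = snd_pos[OF y]
  let ?Z = "\<lambda>\<omega>. if \<exists>k. t < T y \<omega> (Suc k) then h (Y 0 \<beta> l A ell y t \<omega>) else 0"
  have "nonexploding_law h t y \<le> (\<integral>\<^sup>+\<omega>. 1 \<partial>D)"
    unfolding nonexploding_law_def
  proof (rule nn_integral_mono)
    fix \<omega> assume "\<omega> \<in> space D"
    then show "?Z \<omega> \<le> 1"
      using le[OF post_jump_in_space[OF y]] by (simp add: Y_zero)
  qed
  then show "nonexploding_law h t y \<le> 1"
    by (simp add: D.emeasure_space_1)
  show "backward_rhs h (nonexploding_law h) t y \<in> borel_measurable borel"
    unfolding backward_rhs_def[abs_def] jump_op_def by measurable
  have "?Z \<in> borel_measurable D"
    by measurable
  then have "nonexploding_law h t y = (\<integral>\<^sup>+e. \<integral>\<^sup>+z. \<integral>\<^sup>+\<omega>. ?Z (case_nat (e, z) \<omega>) \<partial>D \<partial>Mk \<partial>Ed)"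
    unfolding nonexploding_law_def by (rule nn_integral_D)
  also have "\<dots> = (\<integral>\<^sup>+e. backward_rhs h (nonexploding_law h) t y e \<partial>Ed)"
  proof (rule nn_integral_cong)
    fix e
    have "t < max 0 (e / snd y) \<longleftrightarrow> t * snd y < e"
      unfolding less_max_iff_disj pos_less_divide_eq[OF pos(1)] using t by auto
    then show "(\<integral>\<^sup>+z. \<integral>\<^sup>+\<omega>. ?Z (case_nat (e, z) \<omega>) \<partial>D \<partial>Mk) = backward_rhs h (nonexploding_law h) t y e"
      unfolding first_jump[OF pos(1)] backward_rhs_def jump_op_def nonexploding_law_def
      by (cases "t * snd y < e") (simp_all only: if_True if_False nn_integral_const
          D.emeasure_space_1 Mk.emeasure_space_1 mult_1_right)
  qed
  finally show "nonexploding_law h t y = (\<integral>\<^sup>+e. backward_rhs h (nonexploding_law h) t y e \<partial>Ed)" .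
qed

lemma unif_semigroup_one:
  assumes "0 \<le> t" "y \<in> space Sp"
  shows "unif_semigroup (\<lambda>_. 1) t y = 1"
proof -
  have "(unif_op ^^ n) (\<lambda>_. 1) y = 1" if "y \<in> space Sp" for n y
    using that
  proof (induction n arbitrary: y)
    case (Suc n)
    have "jump_op ((unif_op ^^ n) (\<lambda>_. 1)) y = jump_op (\<lambda>_. 1) y"
      unfolding jump_op_def by (intro nn_integral_cong Suc.IH jump_in_space Suc.prems)
    then have "(unif_op ^^ Suc n) (\<lambda>_. 1) y = ennreal (snd y / A) * 1 + ennreal (1 - snd y / A) * 1"
      unfolding funpow.simps comp_def unif_op_def[of "(unif_op ^^ n) (\<lambda>_. 1)"] jump_op_one Suc.IH[OF Suc.prems] by simp
    also have "\<dots> = 1"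
      using snd_pos[OF Suc.prems] A_pos by (simp add: ennreal_plus[symmetric] del: ennreal_plus)
    finally show ?case .
  qed simp
  then show ?thesis
    using assms A_pos suminf_poisson[of "A * t"] by (simp only: unif_semigroup_def mult_1_right mult_nonneg_nonneg less_imp_le)
qed

text \<open>Uniqueness for the backward equation identifies \<open>nonexploding_law\<close> with the
  uniformised semigroup. Applied to the constant \<open>1\<close>, it shows that almost no path
  explodes before \<open>t\<close>, so the true law of \<open>Y\<close> has the same value.\<close>

lemma emeasure_transition:
  assumes B: "B \<in> sets Sp" and t: "0 \<le> t" and y [measurable]: "y \<in> space Sp"
  shows "emeasure (transition G 0 \<beta> l A ell t y) B = unif_semigroup (indicator B) t y"
proof -
  interpret D: prob_space D by (rule prob_space_D)
  note [measurable] = B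
  let ?good = "\<lambda>\<omega>. \<exists>k. t < T y \<omega> (Suc k)"
  have UV: "nonexploding_law h t y = unif_semigroup h t y" if "h \<in> borel_measurable Sp" "\<And>y. h y \<le> 1" for h
    using that by (intro backward_unique[OF backward_solution_nonexploding_law backward_solution_unif_semigroup] t y)
  have good_sets: "{\<omega> \<in> space D. ?good \<omega>} \<in> sets D"
    by measurable
  have "emeasure D {\<omega> \<in> space D. ?good \<omega>} = (\<integral>\<^sup>+\<omega>. indicator {\<omega> \<in> space D. ?good \<omega>} \<omega> \<partial>D)"
    by (rule nn_integral_indicator[OF good_sets, symmetric])
  also have "\<dots> = nonexploding_law (\<lambda>_. 1) t y"
    unfolding nonexploding_law_def by (intro nn_integral_cong) (simp split: split_indicator)
  also have "\<dots> = 1"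
    using t y by (simp add: UV unif_semigroup_one)
  finally have "D.prob {\<omega> \<in> space D. ?good \<omega>} = 1"
    by (simp add: measure_def)
  then have good: "AE \<omega> in D. ?good \<omega>"
    by (simp only: D.prob_Collect_eq_1[OF good_sets])
  have "emeasure (transition G 0 \<beta> l A ell t y) B =
      (\<integral>\<^sup>+z. indicator B z \<partial>transition G 0 \<beta> l A ell t y)"
    by (simp add: transition_def B)
  also have "\<dots> = (\<integral>\<^sup>+\<omega>. indicator B (Y 0 \<beta> l A ell y t \<omega>) \<partial>D)"
    unfolding transition_def by (rule nn_integral_distr) measurable
  also have "\<dots> = nonexploding_law (indicator B) t y"
    unfolding nonexploding_law_def using good by (intro nn_integral_cong_AE) (elim eventually_mono, simp only: if_True)
  also have "\<dots> = unif_semigroup (indicator B) t y"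
    by (rule UV) (auto split: split_indicator)
  finally show ?thesis .
qed

text \<open>The transition probability is a Poisson mixture of powers of \<open>unif_op\<close>. Sum
  and integral of nonnegative terms may be exchanged, each power leaves the integral unchanged, and
  the weights sum to one; infinite mass is no obstacle.\<close>

lemma invariant_Pi_measure:
  assumes lim: "(\<lambda>k. (killed_op ^^ k) (\<lambda>_. 1) (0, l)) \<longlonglongrightarrow> 0"
  shows "invariant_measure G 0 \<beta> l A ell (Pi_measure c)"
  unfolding invariant_measure_def
proof (intro conjI allI impI ballI)
  fix t :: real and B assume t: "0 \<le> t" and B [measurable]: "B \<in> sets Sp"
  let ?p = "\<lambda>n. ennreal (exp (- (A * t)) * (A * t) ^ n / fact n)"
  have "(\<integral>\<^sup>+y. emeasure (transition G 0 \<beta> l A ell t y) B \<partial>Pi_measure c) =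
      (\<integral>\<^sup>+y. (\<Sum>n. ?p n * (unif_op ^^ n) (indicator B) y) \<partial>Pi_measure c)"
    by (intro nn_integral_cong) (simp add: emeasure_transition B t unif_semigroup_def)
  also have "\<dots> = (\<Sum>n. ?p n * (\<integral>\<^sup>+y. (unif_op ^^ n) (indicator B) y \<partial>Pi_measure c))"
    by (subst nn_integral_suminf) (simp_all add: nn_integral_cmult)
  also have "\<dots> = (\<Sum>n. ?p n) * (\<integral>\<^sup>+y. indicator B y \<partial>Pi_measure c)"
    using Pi_measure_unif_op_power[OF borel_measurable_indicator[OF B] lim]
    by (simp only: ennreal_suminf_multc)
  also have "\<dots> = emeasure (Pi_measure c) B"
    using t A_pos by (subst suminf_poisson) (simp_all add: B)
  finally show "(\<integral>\<^sup>+y. emeasure (transition G 0 \<beta> l A ell t y) B \<partial>Pi_measure c) = emeasure (Pi_measure c) B" .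
qed simp

end

section \<open>Slices of the invariant measure\<close>

lemma interval_measure_cdf:
  assumes "real_distribution N"
  shows "interval_measure (cdf N) = N"
proof -
  interpret real_distribution N by fact
  note F = cdf_nondecreasing cdf_is_right_cont cdf_lim_at_bot cdf_lim_at_top_prob
  show ?thesis
    by (rule cdf_unique) (auto intro!: real_distribution_interval_measure cdf_interval_measure F assms)
qed

lemma cdf_shift:
  fixes N :: "real measure"
  assumes "f \<in> borel_measurable N"
  shows "cdf (distr N borel (\<lambda>z. c + f z)) x = cdf (distr N borel f) (x - c)"
  using assms unfolding cdf_def
  by (subst (1 2) measure_distr) (auto intro!: arg_cong[where f = "measure N"])

section \<open>Recursion for the slices and the reset rate\<close>

context resetting_process
begin

text \<open>The law with distribution function \<open>G_ell M Z ell (Suc n)\<close>, expressed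
  through the mark law because \<open>Z\<close> does not occur in the locale.\<close>

definition increment_law :: "nat \<Rightarrow> real measure" where
  "increment_law n = distr Mk borel (ell (Suc n))"

lemma prob_space_increment_law: "prob_space (increment_law n)"
  unfolding increment_law_def by (rule prob_space.prob_space_distr[OF mark_prob measurable_ell])

lemma sets_increment_law [simp, measurable_cong]: "sets (increment_law n) = sets borel"
  by (simp add: increment_law_def)

lemma nn_integral_increment_law:
  "g \<in> borel_measurable borel \<Longrightarrow> (\<integral>\<^sup>+x. g x \<partial>increment_law n) = (\<integral>\<^sup>+z. g (ell (Suc n) z) \<partial>Mk)"
  unfolding increment_law_def by (rule nn_integral_distr) measurable

lemma killed_op_power_cong_count:
  assumes "\<And>y. y \<in> space Sp \<Longrightarrow> fst y = k \<Longrightarrow> f y = g y"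
  shows "(killed_op ^^ k) f (0, l) = (killed_op ^^ k) g (0, l)"
proof -
  have "(killed_op ^^ k) (\<lambda>y. if fst y = k then f y else 0) (0, l) = (killed_op ^^ k) (\<lambda>y. if fst y = k then g y else 0) (0, l)"
    using assms by (intro killed_op_power_cong start_in_space) auto
  then show ?thesis
    by (simp add: killed_op_power_count start_in_space)
qed

lemma killed_op_power_one_le: "(killed_op ^^ k) (\<lambda>_. 1) (0, l) \<le> 1"
proof -
  interpret D: prob_space D by (rule prob_space_D)
  have "(killed_op ^^ k) (\<lambda>_. 1) (0, l) \<le> (\<integral>\<^sup>+\<omega>. 1 \<partial>D)"
    unfolding killed_op_power_eq[OF borel_measurable_const start_in_space] by (intro nn_integral_mono) simp
  then show ?thesis
    by (simp add: D.emeasure_space_1)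
qed

text \<open>Weighting by the intensity undoes the density \<open>1 / snd y\<close>, so the weighted
  slice is \<open>c\<close> times the subprobability law of the intensity after \<open>n\<close>
  surviving jumps.\<close>

lemma nn_integral_weighted_slice:
  assumes [measurable]: "g \<in> borel_measurable borel"
  shows "(\<integral>\<^sup>+x. g x \<partial>weighted_slice (Pi_measure c) n) = c * (killed_op ^^ n) (\<lambda>y. g (snd y)) (0, l)"
proof -
  have "(\<integral>\<^sup>+x. g x \<partial>weighted_slice (Pi_measure c) n) = (\<integral>\<^sup>+x. ennreal x * g x \<partial>slice (Pi_measure c) n)"
    unfolding weighted_slice_def
    by (rule nn_integral_density) (simp_all add: measurable_cong_sets[OF sets_slice refl])
  also have "\<dots> = c * (killed_op ^^ n) (\<lambda>y. ennreal (1 / snd y) * (ennreal (snd y) * g (snd y))) (0, l)"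
    by (rule nn_integral_slice) measurable
  also have "(killed_op ^^ n) (\<lambda>y. ennreal (1 / snd y) * (ennreal (snd y) * g (snd y))) (0, l) =
      (killed_op ^^ n) (\<lambda>y. g (snd y)) (0, l)"
  proof (intro killed_op_power_cong start_in_space)
    fix y assume "y \<in> space Sp"
    then have "ennreal (1 / snd y) * ennreal (snd y) = 1"
      using snd_pos(1)[of y] by (simp add: ennreal_mult'[symmetric])
    then show "ennreal (1 / snd y) * (ennreal (snd y) * g (snd y)) = g (snd y)"
      by (simp add: mult.assoc[symmetric])
  qed
  finally show ?thesis .
qed

lemma sets_weighted_slice [simp]: "sets (weighted_slice \<mu> n) = sets borel"
  by (simp add: weighted_slice_def)

text \<open>The mass is \<open>r\<close> times a survival probability. Finiteness gives access to
  the convolution formulas, although the whole measure may be infinite.\<close>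

lemma finite_weighted_slice: "finite_measure (weighted_slice (Pi_measure (ennreal r)) n)"
proof
  have "emeasure (weighted_slice (Pi_measure (ennreal r)) n) (space (weighted_slice (Pi_measure (ennreal r)) n))
      = (\<integral>\<^sup>+x. 1 \<partial>weighted_slice (Pi_measure (ennreal r)) n)"
    by simp
  also have "\<dots> = ennreal r * (killed_op ^^ n) (\<lambda>_. 1) (0, l)"
    by (rule nn_integral_weighted_slice) simp
  also have "\<dots> \<le> ennreal r * 1"
    by (intro mult_left_mono killed_op_power_one_le) simp
  also have "\<dots> < \<infinity>" by simp
  finally show "emeasure (weighted_slice (Pi_measure (ennreal r)) n)
      (space (weighted_slice (Pi_measure (ennreal r)) n)) \<noteq> \<infinity>" by simp
qed

lemma emeasure_slice:
  assumes B: "B \<in> sets borel"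
  shows "emeasure (slice (Pi_measure c) n) B = c * (killed_op ^^ n) (\<lambda>y. ennreal (1 / snd y) * indicator B (snd y)) (0, l)"
proof -
  have "emeasure (slice (Pi_measure c) n) B = (\<integral>\<^sup>+x. indicator B x \<partial>slice (Pi_measure c) n)"
    by (simp add: B)
  also have "\<dots> = c * (killed_op ^^ n) (\<lambda>y. ennreal (1 / snd y) * indicator B (snd y)) (0, l)"
    using B by (intro nn_integral_slice) simp
  finally show ?thesis .
qed

lemma slice_0: "slice (Pi_measure c) 0 = scale_measure (c * ennreal (1 / l)) (return borel l)"
  by (rule measure_eqI) (simp_all add: emeasure_slice mult.assoc)

text \<open>Killing becomes the indicator of \<open>{l..<A}\<close>: its upper bound expresses that
  no reset occurs, and its lower bound is automatic because increments are positive.\<close>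

lemma killed_op_slice_density:
  assumes [measurable]: "B \<in> sets borel" and y: "y \<in> space Sp"
  shows "killed_op (\<lambda>y. ennreal (1 / snd y) * indicator B (snd y)) y =
    (\<integral>\<^sup>+z. ennreal (1 / (snd y + ell (Suc (fst y)) z)) * indicator {l..<A} (snd y + ell (Suc (fst y)) z)
       * indicator B (snd y + ell (Suc (fst y)) z) \<partial>Mk)"
  unfolding killed_op_def
proof (rule nn_integral_cong)
  fix z assume "z \<in> space Mk"
  then have "l \<le> snd y + ell (Suc (fst y)) z"
    using snd_pos(3)[OF y] ell_pos[of z "fst y"] by (simp add: space_Mk)
  then show "(if A \<le> snd y + ell (Suc (fst y)) z then 0
      else ennreal (1 / snd (J y z)) * indicator B (snd (J y z))) =
    ennreal (1 / (snd y + ell (Suc (fst y)) z)) * indicator {l..<A} (snd y + ell (Suc (fst y)) z)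
      * indicator B (snd y + ell (Suc (fst y)) z)"
    by (simp add: jump_eq)
qed

lemma slice_1:
  assumes "0 \<le> r"
  shows "slice (Pi_measure (ennreal r)) 1 = density (distr Mk borel (\<lambda>z. l + ell (Suc 0) z))
    (\<lambda>x. ennreal (r / x) * indicator {l..<A} x)"
proof (rule measure_eqI)
  fix B assume "B \<in> sets (slice (Pi_measure (ennreal r)) 1)"
  then have B [measurable]: "B \<in> sets borel" by simp
  have "emeasure (density (distr Mk borel (\<lambda>z. l + ell (Suc 0) z)) (\<lambda>x. ennreal (r / x) * indicator {l..<A} x)) B
      = (\<integral>\<^sup>+z. ennreal (r / (l + ell (Suc 0) z)) * indicator {l..<A} (l + ell (Suc 0) z)
          * indicator B (l + ell (Suc 0) z) \<partial>Mk)"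
    by (subst emeasure_density) (simp_all add: nn_integral_distr)
  also have "\<dots> = (\<integral>\<^sup>+z. ennreal r * (ennreal (1 / (l + ell (Suc 0) z)) * indicator {l..<A} (l + ell (Suc 0) z)
          * indicator B (l + ell (Suc 0) z)) \<partial>Mk)"
    using assms by (intro nn_integral_cong) (auto simp: ennreal_mult'[symmetric] split: split_indicator)
  also have "\<dots> = ennreal r * killed_op (\<lambda>y. ennreal (1 / snd y) * indicator B (snd y)) (0, l)"
    by (subst nn_integral_cmult) (simp_all add: killed_op_slice_density start_in_space)
  also have "\<dots> = emeasure (slice (Pi_measure (ennreal r)) 1) B"
    by (simp add: emeasure_slice)
  finally show "emeasure (slice (Pi_measure (ennreal r)) 1) B =
    emeasure (density (distr Mk borel (\<lambda>z. l + ell (Suc 0) z)) (\<lambda>x. ennreal (r / x) * indicator {l..<A} x)) B" ..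
qed simp

text \<open>One further surviving jump adds an independent increment to the intensity, which gives
  the convolution; survival restricts it to \<open>{l..<A}\<close>, and the holding time contributes
  \<open>1 / x\<close>.\<close>

lemma slice_Suc:
  "slice (Pi_measure (ennreal r)) (Suc n) =
    density (convolution (increment_law n) (weighted_slice (Pi_measure (ennreal r)) n))
      (\<lambda>x. ennreal (1 / x) * indicator {l..<A} x)"
proof (rule measure_eqI)
  let ?P = "Pi_measure (ennreal r)"
  let ?f = "\<lambda>B x. ennreal (1 / x) * indicator {l..<A} x * indicator B x"
  interpret W: finite_measure "weighted_slice ?P n" by (rule finite_weighted_slice)
  interpret L: prob_space "increment_law n" by (rule prob_space_increment_law)
  fix B assume "B \<in> sets (slice ?P (Suc n))"
  then have B [measurable]: "B \<in> sets borel" by simp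
  have "emeasure (density (convolution (increment_law n) (weighted_slice ?P n))
        (\<lambda>x. ennreal (1 / x) * indicator {l..<A} x)) B =
      (\<integral>\<^sup>+x. ?f B x \<partial>convolution (weighted_slice ?P n) (increment_law n))"
    by (subst emeasure_density, simp_all add: B)
      \<comment> \<open>The factors are exchanged so that the weighted slice becomes the outer
        integral.\<close>
      (subst convolution_commutative, simp_all add: W.finite_measure_axioms L.finite_measure_axioms)
  also have "\<dots> = (\<integral>\<^sup>+x. \<integral>\<^sup>+u. ?f B (x + u) \<partial>increment_law n \<partial>weighted_slice ?P n)"
    by (rule nn_integral_convolution) (simp_all add: W.finite_measure_axioms L.finite_measure_axioms)
  also have "\<dots> = ennreal r * (killed_op ^^ n) (\<lambda>y. \<integral>\<^sup>+u. ?f B (snd y + u) \<partial>increment_law n) (0, l)"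
    by (rule nn_integral_weighted_slice) measurable
  also have "(killed_op ^^ n) (\<lambda>y. \<integral>\<^sup>+u. ?f B (snd y + u) \<partial>increment_law n) (0, l) =
      (killed_op ^^ n) (killed_op (\<lambda>y. ennreal (1 / snd y) * indicator B (snd y))) (0, l)"
    \<comment> \<open>After \<open>n\<close> surviving jumps from \<open>(0, l)\<close> the count is
      \<open>n\<close>, so the next increment has law \<open>increment_law n\<close>.\<close>
    by (rule killed_op_power_cong_count) (simp add: killed_op_slice_density nn_integral_increment_law)
  also have "ennreal r * \<dots> = emeasure (slice ?P (Suc n)) B"
    by (simp add: emeasure_slice B funpow_swap1)
  finally show "emeasure (slice ?P (Suc n)) B =
    emeasure (density (convolution (increment_law n) (weighted_slice ?P n))
        (\<lambda>x. ennreal (1 / x) * indicator {l..<A} x)) B" ..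
qed simp

text \<open>The summand for \<open>m\<close> is \<open>c\<close> times the probability that the
  excursion ends at the jump with index \<open>m\<close>; the factor \<open>x\<close> cancels the
  holding-time density. These probabilities sum to one.\<close>

lemma suminf_slice_reset:
  assumes lim: "(\<lambda>k. (killed_op ^^ k) (\<lambda>_. 1) (0, l)) \<longlonglongrightarrow> 0"
  shows "(\<Sum>m. \<integral>\<^sup>+x\<in>{l..<A}. ennreal (x * (1 - measure (increment_law m) {..<A - x})) \<partial>slice (Pi_measure c) m) = c"
proof -
  have "(\<integral>\<^sup>+x\<in>{l..<A}. ennreal (x * (1 - measure (increment_law m) {..<A - x})) \<partial>slice (Pi_measure c) m) =
      c * (killed_op ^^ m) reset_prob (0, l)" for m
  proof -
    interpret L: prob_space "increment_law m" by (rule prob_space_increment_law)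
    have "mono (\<lambda>a. measure (increment_law m) {..<a})"
      by (intro monoI L.finite_measure_mono) auto
    then have [measurable]: "(\<lambda>a. measure (increment_law m) {..<a}) \<in> borel_measurable borel"
      by (rule borel_measurable_mono)
    have "(\<integral>\<^sup>+x\<in>{l..<A}. ennreal (x * (1 - measure (increment_law m) {..<A - x})) \<partial>slice (Pi_measure c) m) =
        c * (killed_op ^^ m) (\<lambda>y. ennreal (1 / snd y) *
          (ennreal (snd y * (1 - measure (increment_law m) {..<A - snd y})) * indicator {l..<A} (snd y))) (0, l)"
      by (rule nn_integral_slice) measurable
    also have "(killed_op ^^ m) (\<lambda>y. ennreal (1 / snd y) *
        (ennreal (snd y * (1 - measure (increment_law m) {..<A - snd y})) * indicator {l..<A} (snd y))) (0, l) =
        (killed_op ^^ m) reset_prob (0, l)"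
    proof (rule killed_op_power_cong_count)
      fix y assume y: "y \<in> space Sp" "fst y = m"
      note pos = snd_pos[OF y(1)]
      \<comment> \<open>A reset includes the case of equality with \<open>A\<close>, which is why
        the open half-line is removed and the left limit of the tail appears.\<close>
      have "1 - measure (increment_law m) {..<A - snd y} = measure (increment_law m) {A - snd y..}"
        using L.prob_compl[of "{..<A - snd y}"] sets_eq_imp_space_eq[OF sets_increment_law[of m]]
        by (simp add: Compl_eq_Diff_UNIV[symmetric] Compl_lessThan)
      then have "ennreal (1 - measure (increment_law m) {..<A - snd y}) =
          (\<integral>\<^sup>+u. indicator {A - snd y..} u \<partial>increment_law m)"
        by (simp add: L.emeasure_eq_measure)
      also have "\<dots> = reset_prob y"
        by (subst nn_integral_increment_law)
           (auto simp: reset_prob_def y(2) intro!: nn_integral_cong split: split_indicator)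
      finally show "ennreal (1 / snd y) * (ennreal (snd y * (1 - measure (increment_law m) {..<A - snd y}))
          * indicator {l..<A} (snd y)) = reset_prob y"
        using pos by (simp add: ennreal_mult'[symmetric])
    qed
    finally show ?thesis .
  qed
  then show ?thesis
    by (simp add: suminf_reset_prob[OF start_in_space lim])
qed

text \<open>The results are collected without the auxiliary operators, so that outside the locale
  only the laws built from \<open>mark_law G\<close> remain to be identified.\<close>

lemma invariant_measure_exists:
  assumes "measure D {\<omega> \<in> space D. T_A 0 \<beta> l A ell (0, l) \<omega> < \<infinity>} = 1" and "0 \<le> r"
  shows "\<exists>\<mu>. invariant_measure G 0 \<beta> l A ell \<mu> \<and>
    slice \<mu> 0 = scale_measure (ennreal (r / l)) (return borel l) \<and>
    slice \<mu> 1 = density (distr Mk borel (\<lambda>z. l + ell (Suc 0) z))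
      (\<lambda>x. ennreal (r / x) * indicator {l..<A} x) \<and>
    (\<forall>n. slice \<mu> (Suc n) =
      density (convolution (distr Mk borel (ell (Suc n))) (weighted_slice \<mu> n))
        (\<lambda>x. ennreal (1 / x) * indicator {l..<A} x)) \<and>
    (\<Sum>m. \<integral>\<^sup>+x\<in>{l..<A}. ennreal (x * (1 - measure (distr Mk borel (ell (Suc m))) {..<A - x})) \<partial>slice \<mu> m)
      = ennreal r"
proof (intro exI conjI allI)
  have lim: "(\<lambda>k. (killed_op ^^ k) (\<lambda>_. 1) (0, l)) \<longlonglongrightarrow> 0"
    by (rule killed_op_power_one_tendsto[OF start_in_space assms(1)])
  let ?\<mu> = "Pi_measure (ennreal r)"
  show "invariant_measure G 0 \<beta> l A ell ?\<mu>"
    by (rule invariant_Pi_measure[OF lim])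
  show "slice ?\<mu> 0 = scale_measure (ennreal (r / l)) (return borel l)"
    using \<open>0 \<le> r\<close> l_pos by (simp add: slice_0 ennreal_mult'[symmetric])
  show "slice ?\<mu> 1 = density (distr Mk borel (\<lambda>z. l + ell (Suc 0) z))
      (\<lambda>x. ennreal (r / x) * indicator {l..<A} x)"
    by (rule slice_1[OF \<open>0 \<le> r\<close>])
  show "slice ?\<mu> (Suc n) = density (convolution (distr Mk borel (ell (Suc n))) (weighted_slice ?\<mu> n))
      (\<lambda>x. ennreal (1 / x) * indicator {l..<A} x)" for n
    using slice_Suc by (simp only: increment_law_def)
  show "(\<Sum>m. \<integral>\<^sup>+x\<in>{l..<A}. ennreal (x * (1 - measure (distr Mk borel (ell (Suc m))) {..<A - x})) \<partial>slice ?\<mu> m)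
      = ennreal r"
    using suminf_slice_reset[OF lim] by (simp only: increment_law_def)
qed

end

section \<open>Transfer to the given variables\<close>

theorem theorem4p4:
  fixes M :: "'w measure" and Z :: "nat \<Rightarrow> 'w \<Rightarrow> real" and G :: "real \<Rightarrow> real"
    and ell :: "nat \<Rightarrow> real \<Rightarrow> real" and \<alpha> \<beta> A l K0 :: real
  assumes "\<alpha> \<ge> 0" and "\<beta> > 0" and "\<beta> < A" and "0 < l" and "l \<le> \<beta>"
    and "prob_space M"
    and "prob_space.indep_vars M (\<lambda>_. borel) Z {1..}"
    and "\<And>i. i \<ge> 1 \<Longrightarrow> cdf (distr M borel (Z i)) = G"
    and "\<And>i \<omega>. i \<ge> 1 \<Longrightarrow> \<omega> \<in> space M \<Longrightarrow> Z i \<omega> \<ge> 0"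
    and "\<And>i. i \<ge> 1 \<Longrightarrow> integrable M (\<lambda>\<omega>. (Z i \<omega>)\<^sup>2)"
    and "\<And>n z. n \<ge> 1 \<Longrightarrow> z \<ge> 0 \<Longrightarrow> ell n z > 0"
    and "\<And>n. n \<ge> 1 \<Longrightarrow> mono_on {0..} (ell n)"
    and "\<And>n. n \<ge> 1 \<Longrightarrow> continuous_on {0..} (ell n)"
    and "\<And>y. y \<in> S_Y l A \<Longrightarrow>
           measure (driving_space G)
             {\<omega> \<in> space (driving_space G). T_A \<alpha> \<beta> l A ell y \<omega> < \<infinity>} = 1"
    and "\<alpha> = 0"
    and "K0 > 0"
  shows "\<exists>\<mu>. invariant_measure G \<alpha> \<beta> l A ell \<mu> \<and>
    slice \<mu> 0 = scale_measure (ennreal (K0 / l)) (return borel l) \<and>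
    slice \<mu> 1 = density (interval_measure (\<lambda>x. G_ell M Z ell 1 (x - l)))
                  (\<lambda>x. ennreal (K0 / x) * indicator {l..<A} x) \<and>
    (\<forall>n\<ge>2. slice \<mu> n = density (H M Z ell \<mu> n) (\<lambda>x. ennreal (1 / x) * indicator {l..<A} x)) \<and>
    ennreal K0 = (\<Sum>m. \<integral>\<^sup>+x\<in>{l..<A}.
        ennreal (x * G_ell_bar_left M Z ell (Suc m) (A - x)) \<partial>slice \<mu> m)"
proof -
  interpret M: prob_space M by fact
  have Z [measurable]: "Z n \<in> borel_measurable M" if "1 \<le> n" for n
    using assms(7) that unfolding M.indep_vars_def by auto
  \<comment> \<open>Each \<open>Z n\<close> has distribution function \<open>G\<close> and is
    nonnegative, so restricting its law to the half-line gives the mark law of the driving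
    sequence.\<close>
  have mark: "mark_law G = distr M (restrict_space borel {0..}) (Z n)" if "1 \<le> n" for n
  proof -
    have "interval_measure G = distr M borel (Z n)"
      using interval_measure_cdf[of "distr M borel (Z n)"] assms(8)[OF that] Z[OF that] by simp
    then show ?thesis
      using assms(9)[OF that] Z[OF that] unfolding mark_law_def by (simp add: restrict_distr)
  qed
  have Z_restrict: "Z n \<in> M \<rightarrow>\<^sub>M restrict_space borel {0..}" if "1 \<le> n" for n
    using Z[OF that] assms(9)[OF that] by (intro measurable_restrict_space2) auto
  have mark_prob: "prob_space (mark_law G)"
    unfolding mark[OF order.refl] by (rule M.prob_space_distr) (simp add: Z_restrict)
  have process: "resetting_process G l A ell"
    by (rule resetting_process.intro[OF mark_prob]) (use assms in auto)
  note measurable_ell = resetting_process.measurable_ell[OF process]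
  obtain \<mu> where \<mu>: "invariant_measure G 0 \<beta> l A ell \<mu>"
    "slice \<mu> 0 = scale_measure (ennreal (K0 / l)) (return borel l)"
    "slice \<mu> 1 = density (distr (mark_law G) borel (\<lambda>z. l + ell (Suc 0) z))
      (\<lambda>x. ennreal (K0 / x) * indicator {l..<A} x)"
    "\<And>n. slice \<mu> (Suc n) =
      density (convolution (distr (mark_law G) borel (ell (Suc n))) (weighted_slice \<mu> n))
        (\<lambda>x. ennreal (1 / x) * indicator {l..<A} x)"
    "(\<Sum>m. \<integral>\<^sup>+x\<in>{l..<A}. ennreal (x * (1 - measure (distr (mark_law G) borel (ell (Suc m))) {..<A - x})) \<partial>slice \<mu> m)
      = ennreal K0"
  proof -
    have "(0, l) \<in> S_Y l A"
      using assms by (simp add: S_Y_def)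
    then have reset: "measure (driving_space G)
        {\<omega> \<in> space (driving_space G). T_A 0 \<beta> l A ell (0, l) \<omega> < \<infinity>} = 1"
      using assms(14) \<open>\<alpha> = 0\<close> by blast
    \<comment> \<open>The free scale \<open>r\<close> is taken to be \<open>K0\<close>.\<close>
    show ?thesis
      using resetting_process.invariant_measure_exists[OF process reset less_imp_le[OF \<open>K0 > 0\<close>]] that
      by blast
  qed
  have real_law: "real_distribution (distr (mark_law G) borel f)" if "f \<in> borel_measurable (mark_law G)" for f
    by (rule prob_space.real_distribution_distr[OF mark_prob that])
  have G_ell: "G_ell M Z ell (Suc n) = cdf (distr (mark_law G) borel (ell (Suc n)))" for n
  proof -
    have "distr (mark_law G) borel (ell (Suc n)) =
        distr (distr M (restrict_space borel {0..}) (Z (Suc n))) borel (ell (Suc n))"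
      unfolding mark[of "Suc n", simplified] ..
    also have "\<dots> = distr M borel (\<lambda>\<omega>. ell (Suc n) (Z (Suc n) \<omega>))"
      using measurable_ell[of n] Z_restrict[of "Suc n"]
      by (subst distr_distr) (simp_all add: comp_def measurable_cong_sets[OF resetting_process.sets_Mk[OF process] refl])
    finally show ?thesis
      by (simp add: G_ell_def)
  qed
  \<comment> \<open>The left limit of a distribution function at \<open>a\<close> is the mass of the
    open half-line below \<open>a\<close>.\<close>
  have bar: "G_ell_bar_left M Z ell (Suc n) a = 1 - measure (distr (mark_law G) borel (ell (Suc n))) {..<a}" for n a
  proof -
    have "((\<lambda>x. 1 - cdf (distr (mark_law G) borel (ell (Suc n))) x) \<longlongrightarrow>
        1 - measure (distr (mark_law G) borel (ell (Suc n))) {..<a}) (at_left a)"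
      by (intro tendsto_diff tendsto_const finite_borel_measure.cdf_at_left
          real_distribution.finite_borel_measure_M real_law measurable_ell)
    then show ?thesis
      unfolding G_ell_bar_left_def G_ell by (intro tendsto_Lim) simp
  qed
  have first: "interval_measure (\<lambda>x. G_ell M Z ell 1 (x - l)) = distr (mark_law G) borel (\<lambda>z. l + ell (Suc 0) z)"
  proof -
    have "(\<lambda>x. G_ell M Z ell 1 (x - l)) = cdf (distr (mark_law G) borel (\<lambda>z. l + ell (Suc 0) z))"
      using G_ell[of 0] cdf_shift[OF measurable_ell[of 0]] by (simp add: fun_eq_iff)
    then show ?thesis
      using measurable_ell[of 0] by (simp add: interval_measure_cdf real_law)
  qed
  have later: "slice \<mu> n = density (H M Z ell \<mu> n) (\<lambda>x. ennreal (1 / x) * indicator {l..<A} x)" if "2 \<le> n" for n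
  proof -
    \<comment> \<open>Since \<open>H\<close> at \<open>n\<close> uses the weighted slice at
      \<open>n - 1\<close>, the successor form matches the recursion.\<close>
    obtain m where n: "n = Suc m"
      using \<open>2 \<le> n\<close> by (cases n) auto
    show ?thesis
      unfolding n H_def G_ell interval_measure_cdf[OF real_law[OF measurable_ell]] by (simp add: \<mu>(4))
  qed
  show ?thesis
    using \<mu>(1-3,5) later unfolding first bar \<open>\<alpha> = 0\<close> by (intro exI[of _ \<mu>]) simp
qed

end
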